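(* Given any fair division instance $\mathcal{I}=\langle [n],[m],\{v_i\}_{i=1}^n \rangle$ with range parameter $\gamma \in [1/2,1]$, one can compute an exact tEFx allocation in polynomial time.
   Context: A fair division instance $\langle [n],[m],\{v_i\}_{i=1}^n\rangle$ consists of agents $[n]=\{1,\dots,n\}$, indivisible goods $[m]=\{1,\dots,m\}$, and additive valuations $v_i:2^{[m]}\to\mathbb{R}_{\ge 0}$, i.e. $v_i(S)=\sum_{g\in S}v_i(g)$. Let $P_i=\{g\in[m]:v_i(g)>0\}$. Throughout, $P_i\neq\emptyset$ for every agent $i$, and every good has positive value for at least one agent. For a good $g$, $\gamma_g=\frac{\min_{j:v_j(g)>0}v_j(g)}{\max_i v_i(g)}$; the range parameter of the instance is $\gamma=\min_{g\in[m]}\gamma_g\in(0,1]$. Write $S+g=S\cup\{g\}$, $S-g=S\setminus\{g\}$. An allocation $\mathcal{A}=(A_1,\dots,A_n)$ is a tuple of pairwise disjoint subsets of $[m]$ with $\bigcup_i A_i=[m]$. It is exact tEFx (envy-free up to the transfer of any positively-valued good) if for every pair of agents $i,j\in[n]$ and every good $g\in A_j\cap P_i$ we have $v_i(A_i+g)\ge v_i(A_j-g)$. *)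

theory Defs
  imports Complex_Main "HOL-Computational_Algebra.Polynomial"
begin

section \<open>Fair division\<close>

text \<open>Agents are \<open>{1..n}\<close>, goods are \<open>{1..m}\<close>, and \<open>v i S\<close> is the value of the bundle \<open>S\<close> for
  agent \<open>i\<close>; the value of a single good \<open>g\<close> is \<open>v i {g}\<close>. Nothing is required of \<open>v\<close> outside
  these ranges.\<close>

definition positive_goods :: "nat \<Rightarrow> (nat \<Rightarrow> nat set \<Rightarrow> real) \<Rightarrow> nat \<Rightarrow> nat set" where
  "positive_goods m v i = {g \<in> {1..m}. v i {g} > 0}"

text \<open>Since \<open>n \<ge> 1\<close> and every agent values some good, \<open>m \<ge> 1\<close> follows.\<close>

definition fair_division_instance :: "nat \<Rightarrow> nat \<Rightarrow> (nat \<Rightarrow> nat set \<Rightarrow> real) \<Rightarrow> bool" where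
  "fair_division_instance n m v \<longleftrightarrow>
     n \<ge> 1 \<and>
     (\<forall>i\<in>{1..n}. \<forall>S. S \<subseteq> {1..m} \<longrightarrow> v i S \<ge> 0 \<and> v i S = (\<Sum>g\<in>S. v i {g})) \<and>
     (\<forall>i\<in>{1..n}. positive_goods m v i \<noteq> {}) \<and>
     (\<forall>g\<in>{1..m}. \<exists>i\<in>{1..n}. v i {g} > 0)"

definition good_range :: "nat \<Rightarrow> (nat \<Rightarrow> nat set \<Rightarrow> real) \<Rightarrow> nat \<Rightarrow> real" where
  "good_range n v g =
     Min ((\<lambda>j. v j {g}) ` {j \<in> {1..n}. v j {g} > 0}) / Max ((\<lambda>i. v i {g}) ` {1..n})"

definition range_parameter :: "nat \<Rightarrow> nat \<Rightarrow> (nat \<Rightarrow> nat set \<Rightarrow> real) \<Rightarrow> real" where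
  "range_parameter n m v = Min (good_range n v ` {1..m})"

definition allocation :: "nat \<Rightarrow> nat \<Rightarrow> (nat \<Rightarrow> nat set) \<Rightarrow> bool" where
  "allocation n m A \<longleftrightarrow>
     (\<forall>i\<in>{1..n}. \<forall>j\<in>{1..n}. i \<noteq> j \<longrightarrow> A i \<inter> A j = {}) \<and> (\<Union>i\<in>{1..n}. A i) = {1..m}"

definition tEFx :: "nat \<Rightarrow> nat \<Rightarrow> (nat \<Rightarrow> nat set \<Rightarrow> real) \<Rightarrow> (nat \<Rightarrow> nat set) \<Rightarrow> bool" where
  "tEFx n m v A \<longleftrightarrow>
     (\<forall>i\<in>{1..n}. \<forall>j\<in>{1..n}. \<forall>g \<in> A j \<inter> positive_goods m v i.
        v i (A i \<union> {g}) \<ge> v i (A j - {g}))"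


section \<open>Model of computation\<close>

text \<open>A random access machine over the reals, presented as a while language. The memory consists
  of two-dimensional arrays of naturals (for control and indexing) and of reals (for data); a cell
  is addressed by the name of the array and two indices. Scalars are stored in cell \<open>(0, 0)\<close>.

  Assignments and tests take one time unit. The expressions in them have a size fixed by the
  program, so charging for their size would change the time by a constant factor only.

  The arithmetic is restricted to addition, subtraction and comparison, all constants are integers,
  and there is no conversion between reals and naturals. Hence the bit length of the
  numbers grows at most linearly with the running time, and a program that takes polynomially many
  steps in this model also runs in polynomial time on a Turing machine, given rational valuations
  written in binary. Unit-cost multiplication would allow repeated squaring and break this.\<close>

type_synonym cell = "string \<times> nat \<times> nat"

type_synonym state = "(cell \<Rightarrow> nat) \<times> (cell \<Rightarrow> real)"

datatype nexp =
    NConst nat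
  | NRead string nexp nexp
  | NAdd nexp nexp
  | NSub nexp nexp

datatype rexp =
    RConst int
  | RRead string nexp nexp
  | RAdd rexp rexp
  | RSub rexp rexp

datatype bexp =
    NLess nexp nexp
  | NEq nexp nexp
  | RLess rexp rexp
  | Not bexp
  | And bexp bexp

datatype com =
    Skip
  | NAssign string nexp nexp nexp
  | RAssign string nexp nexp rexp
  | Seq com com
  | If bexp com com
  | While bexp com

text \<open>Subtraction of naturals is truncated.\<close>

fun nval :: "nexp \<Rightarrow> state \<Rightarrow> nat" where
  "nval (NConst k) s = k"
| "nval (NRead a e f) s = fst s (a, nval e s, nval f s)"
| "nval (NAdd e f) s = nval e s + nval f s"
| "nval (NSub e f) s = nval e s - nval f s"

fun rval :: "rexp \<Rightarrow> state \<Rightarrow> real" where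
  "rval (RConst k) s = of_int k"
| "rval (RRead a e f) s = snd s (a, nval e s, nval f s)"
| "rval (RAdd e f) s = rval e s + rval f s"
| "rval (RSub e f) s = rval e s - rval f s"

fun bval :: "bexp \<Rightarrow> state \<Rightarrow> bool" where
  "bval (NLess e f) s \<longleftrightarrow> nval e s < nval f s"
| "bval (NEq e f) s \<longleftrightarrow> nval e s = nval f s"
| "bval (RLess e f) s \<longleftrightarrow> rval e s < rval f s"
| "bval (Not b) s \<longleftrightarrow> \<not> bval b s"
| "bval (And b c) s \<longleftrightarrow> bval b s \<and> bval c s"

text \<open>\<open>exec c s t s'\<close>: started in state \<open>s\<close>, the program \<open>c\<close> halts in state \<open>s'\<close> after \<open>t\<close> steps.\<close>

inductive exec :: "com \<Rightarrow> state \<Rightarrow> nat \<Rightarrow> state \<Rightarrow> bool" where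
  Skip: "exec Skip s 1 s"
| NAssign: "exec (NAssign a e f x) s 1 ((fst s)((a, nval e s, nval f s) := nval x s), snd s)"
| RAssign: "exec (RAssign a e f x) s 1 (fst s, (snd s)((a, nval e s, nval f s) := rval x s))"
| Seq: "exec c s t s' \<Longrightarrow> exec d s' t' s'' \<Longrightarrow> exec (Seq c d) s (t + t') s''"
| IfTrue: "bval b s \<Longrightarrow> exec c s t s' \<Longrightarrow> exec (If b c d) s (t + 1) s'"
| IfFalse: "\<not> bval b s \<Longrightarrow> exec d s t s' \<Longrightarrow> exec (If b c d) s (t + 1) s'"
| WhileFalse: "\<not> bval b s \<Longrightarrow> exec (While b c) s 1 s"
| WhileTrue: "bval b s \<Longrightarrow> exec c s t s' \<Longrightarrow> exec (While b c) s' t' s'' \<Longrightarrow>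
    exec (While b c) s (t + t' + 1) s''"

inductive_cases SkipE: "exec Skip s t s'"
inductive_cases NAssignE: "exec (NAssign a e f x) s t s'"
inductive_cases RAssignE: "exec (RAssign a e f x) s t s'"
inductive_cases SeqE: "exec (Seq c d) s t s'"
inductive_cases IfE: "exec (If b c d) s t s'"
inductive_cases WhileE: "exec (While b c) s t s'"

lemma exec_deterministic:
  assumes "exec c s t s'" and "exec c s u r"
  shows "u = t \<and> r = s'"
  using assms
proof (induction arbitrary: u r rule: exec.induct)
  case (Seq c s t s' d t' s'')
  from Seq.prems obtain t1 s1 t2
    where *: "u = t1 + t2" "exec c s t1 s1" "exec d s1 t2 r" by (rule SeqE)
  from Seq.IH(1)[OF *(2)] Seq.IH(2) * show ?case by simp
next
  case (IfTrue b s c t s' d)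
  from IfTrue.prems obtain t1 where *: "u = t1 + 1" "exec c s t1 r"
    by (rule IfE) (use IfTrue.hyps in simp_all)
  from IfTrue.IH[OF *(2)] * show ?case by simp
next
  case (IfFalse b s d t s' c)
  from IfFalse.prems obtain t1 where *: "u = t1 + 1" "exec d s t1 r"
    by (rule IfE) (use IfFalse.hyps in simp_all)
  from IfFalse.IH[OF *(2)] * show ?case by simp
next
  case (WhileFalse b s c)
  from WhileFalse.prems show ?case by (rule WhileE) (use WhileFalse.hyps in simp_all)
next
  case (WhileTrue b s c t s' t' s'')
  from WhileTrue.prems obtain t1 s1 t2
    where *: "u = t1 + t2 + 1" "exec c s t1 s1" "exec (While b c) s1 t2 r"
    by (rule WhileE) (use WhileTrue.hyps in simp_all)
  from WhileTrue.IH(1)[OF *(2)] WhileTrue.IH(2) * show ?case by simp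
next
  case (Skip s)
  then show ?case by (rule SkipE) simp
next
  case (NAssign a e f x s)
  then show ?case by (rule NAssignE) simp
next
  case (RAssign a e f x s)
  then show ?case by (rule RAssignE) simp
qed


section \<open>Input and output\<close>

text \<open>The machine is given \<open>n\<close>, \<open>m\<close> and the values of the single goods, which determine an
  additive valuation. All other cells, which serve as work space, are \<open>0\<close>.\<close>

definition input_state :: "nat \<Rightarrow> nat \<Rightarrow> (nat \<Rightarrow> nat set \<Rightarrow> real) \<Rightarrow> state" where
  "input_state n m v =
     ((\<lambda>_. 0)((''n'', 0, 0) := n, (''m'', 0, 0) := m),
      (\<lambda>(a, i, g). if a = ''v'' \<and> i \<in> {1..n} \<and> g \<in> {1..m} then v i {g} else 0))"

text \<open>The output is read from the array \<open>owner\<close>, which holds for each good the agent receiving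
  it.\<close>

definition output_allocation :: "nat \<Rightarrow> state \<Rightarrow> nat \<Rightarrow> nat set" where
  "output_allocation m s i = {g \<in> {1..m}. fst s (''owner'', g, 0) = i}"

text \<open>One program has to work for all instances in the class \<open>I\<close>, with one polynomial bounding its
  running time; in particular, the number of steps does not depend on the magnitude of the values.
  The input has \<open>n * m + 2\<close> numbers, which for \<open>n, m \<ge> 1\<close> is polynomially equivalent to
  \<open>n + m\<close>.\<close>

definition poly_time_computable ::
  "(nat \<Rightarrow> nat \<Rightarrow> (nat \<Rightarrow> nat set \<Rightarrow> real) \<Rightarrow> bool) \<Rightarrow>
   (nat \<Rightarrow> nat \<Rightarrow> (nat \<Rightarrow> nat set \<Rightarrow> real) \<Rightarrow> (nat \<Rightarrow> nat set) \<Rightarrow> bool) \<Rightarrow> bool" where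
  "poly_time_computable I Q \<longleftrightarrow>
     (\<exists>(c :: com) (p :: nat poly). \<forall>n m v. I n m v \<longrightarrow>
        (\<exists>t s. exec c (input_state n m v) t s \<and> t \<le> poly p (n + m) \<and>
               Q n m v (output_allocation m s)))"

end

theory Submission
  imports Defs
begin

text \<open>Let \<open>w g\<close> (below: \<open>peak g\<close>) be the largest value of the good \<open>g\<close>. The goods are allocated in
  decreasing order of \<open>w\<close>, each to an agent whom nobody envies; such an agent is obtained by
  rotating the held bundles along envy cycles, which decreases the number of pairs of an agent and a
  bundle preferred by it to its own. This maintains \<open>v i (A j) \<le> v i (A i) + w g\<close> for all goods
  \<open>g \<in> A j\<close> valued by \<open>i\<close>: the good given last has the smallest \<open>w\<close>, and only its value is
  added to a bundle that was unenvied. Since the range parameter is at least \<open>1/2\<close>,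
  \<open>w g \<le> 2 * v i {g}\<close>, and so moving \<open>g\<close> from \<open>A j\<close> to \<open>A i\<close> removes the envy.\<close>


section \<open>Cost and frame of a program\<close>

text \<open>The agents disagree about which goods are small, so an order by the values of one agent
  would not serve the others; the peak is a common yardstick that bounds every agent's value from
  above. The range parameter compares it from the other side with the value of each agent that wants
  the good: moving \<open>g\<close> lowers one bundle and raises the other by
  \<open>v i {g}\<close>, which closes a gap of \<open>2 * v i {g}\<close>. This is where
  \<open>1/2\<close> comes from. Bundles are kept apart from their holders. A rotation permutes only
  the map \<open>h\<close>, while the bundles and the table of their values stay put. Running time
  shapes the program: every loop counts up to \<open>n\<close> or \<open>m\<close>, which makes the
  number of steps polynomial by syntax alone. Searches therefore do not stop early; they run for a
  worst-case number of rounds and idle once they have succeeded.\<close>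

text \<open>\<open>cost K c\<close> bounds the number of steps of \<open>c\<close> when each of its loops runs at most \<open>K\<close> times.\<close>

primrec cost :: "nat \<Rightarrow> com \<Rightarrow> nat" where
  "cost K Skip = 1"
| "cost K (NAssign a e f x) = 1"
| "cost K (RAssign a e f x) = 1"
| "cost K (Seq c d) = cost K c + cost K d"
| "cost K (If b c d) = cost K c + cost K d + 1"
| "cost K (While b c) = 1 + K * (cost K c + 1)"

text \<open>The polynomial is assembled along the syntax: a loop multiplies that of its body by the
  indeterminate \<open>[:0, 1:]\<close>, so the degree grows with the nesting of loops.\<close>

lemma cost_polynomial: "\<exists>p :: nat poly. \<forall>K. cost K c = poly p K"
proof (induction c)
  case (Seq c d)
  then obtain p q where "\<forall>K. cost K c = poly p K" "\<forall>K. cost K d = poly q K" by blast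
  then show ?case by (intro exI[of _ "p + q"]) simp
next
  case (If b c d)
  then obtain p q where "\<forall>K. cost K c = poly p K" "\<forall>K. cost K d = poly q K" by blast
  then show ?case by (intro exI[of _ "p + q + 1"]) simp
next
  case (While b c)
  then obtain p where "\<forall>K. cost K c = poly p K" by blast
  then show ?case by (intro exI[of _ "1 + [:0, 1:] * (p + 1)"]) simp
qed (rule exI[of _ 1], simp)+

text \<open>The frame is kept per array name, since the cell hit by an assignment depends on the
  state; a name stands for its natural and its real array alike.\<close>

primrec writes :: "com \<Rightarrow> string set" where
  "writes Skip = {}"
| "writes (NAssign a e f x) = {a}"
| "writes (RAssign a e f x) = {a}"
| "writes (Seq c d) = writes c \<union> writes d"
| "writes (If b c d) = writes c \<union> writes d"
| "writes (While b c) = writes c"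

definition unchanged :: "string set \<Rightarrow> state \<Rightarrow> state \<Rightarrow> bool" where
  "unchanged W s s' \<longleftrightarrow>
     (\<forall>a i j. a \<notin> W \<longrightarrow> fst s' (a, i, j) = fst s (a, i, j) \<and> snd s' (a, i, j) = snd s (a, i, j))"

lemma unchangedD:
  assumes "unchanged W s s'" "a \<notin> W"
  shows "fst s' (a, i, j) = fst s (a, i, j)" "snd s' (a, i, j) = snd s (a, i, j)"
  using assms by (auto simp: unchanged_def)

lemma unchangedI:
  assumes "\<And>a i j. a \<notin> W \<Longrightarrow> fst s' (a, i, j) = fst s (a, i, j)"
    and "\<And>a i j. a \<notin> W \<Longrightarrow> snd s' (a, i, j) = snd s (a, i, j)"
  shows "unchanged W s s'"
  using assms by (simp add: unchanged_def)

lemma unchanged_trans: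
  assumes "unchanged V s s'" "unchanged W s' s''" "V \<union> W \<subseteq> U"
  shows "unchanged U s s''"
proof (rule unchangedI)
  fix a i j assume "a \<notin> U"
  then have "a \<notin> V" "a \<notin> W" using assms(3) by auto
  then show "fst s'' (a, i, j) = fst s (a, i, j)" "snd s'' (a, i, j) = snd s (a, i, j)"
    using assms(1,2) by (simp_all add: unchangedD)
qed

lemma unchanged_mono: "unchanged V s s' \<Longrightarrow> V \<subseteq> W \<Longrightarrow> unchanged W s s'"
  unfolding unchanged_def by auto

lemma exec_unchanged: "exec c s t s' \<Longrightarrow> unchanged (writes c) s s'"
proof (induction rule: exec.induct)
  case (Seq c s t s' d t' s'')
  then show ?case by (auto intro: unchanged_trans)
next
  case (IfTrue b s c t s' d)
  then show ?case by (auto intro: unchanged_mono)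
next
  case (IfFalse b s d t s' c)
  then show ?case by (auto intro: unchanged_mono)
next
  case (WhileTrue b s c t s' t' s'')
  then show ?case by (auto intro: unchanged_trans)
qed (simp_all add: unchanged_def)

section \<open>Total correctness with time bounds\<close>

definition run :: "nat \<Rightarrow> com \<Rightarrow> state \<Rightarrow> (state \<Rightarrow> bool) \<Rightarrow> bool" where
  "run K c s Q \<longleftrightarrow> (\<exists>t s'. exec c s t s' \<and> t \<le> cost K c \<and> Q s')"

text \<open>Hands the frame of the program to the consequence, so that postconditions need only
  speak of what the program changes.\<close>

lemma run_conseq:
  assumes "run K c s P" and "\<And>s'. P s' \<Longrightarrow> unchanged (writes c) s s' \<Longrightarrow> Q s'"
  shows "run K c s Q"
proof -
  obtain t s' where "exec c s t s'" "t \<le> cost K c" "P s'" using assms(1) unfolding run_def by blast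
  with assms(2) exec_unchanged show ?thesis unfolding run_def by blast
qed

lemma run_Skip: "Q s \<Longrightarrow> run K Skip s Q"
  unfolding run_def by (intro exI[of _ 1] exI[of _ s] conjI exec.Skip) simp_all

lemma run_NAssign:
  "Q ((fst s)((a, nval e s, nval f s) := nval x s), snd s) \<Longrightarrow> run K (NAssign a e f x) s Q"
  unfolding run_def
  by (intro exI[of _ 1] exI[of _ "((fst s)((a, nval e s, nval f s) := nval x s), snd s)"] conjI exec.NAssign) simp_all

lemma run_RAssign:
  "Q (fst s, (snd s)((a, nval e s, nval f s) := rval x s)) \<Longrightarrow> run K (RAssign a e f x) s Q"
  unfolding run_def
  by (intro exI[of _ 1] exI[of _ "(fst s, (snd s)((a, nval e s, nval f s) := rval x s))"] conjI exec.RAssign) simp_all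

lemma run_Seq:
  assumes "run K c s P"
    and "\<And>s'. P s' \<Longrightarrow> unchanged (writes c) s s' \<Longrightarrow> run K d s' Q"
  shows "run K (Seq c d) s Q"
proof -
  obtain t s' where c: "exec c s t s'" "t \<le> cost K c" "P s'"
    using assms(1) unfolding run_def by blast
  with assms(2) obtain t' s'' where "exec d s' t' s''" "t' \<le> cost K d" "Q s''"
    using exec_unchanged unfolding run_def by blast
  with c show ?thesis unfolding run_def
    by (intro exI[of _ "t + t'"] exI[of _ s'']) (auto intro: exec.Seq)
qed

lemma run_Seq': "run K c s (\<lambda>s'. run K d s' Q) \<Longrightarrow> run K (Seq c d) s Q"
  by (rule run_Seq[where P = "\<lambda>s'. run K d s' Q"])

lemma run_If:
  assumes "bval b s \<Longrightarrow> run K c s Q" and "\<not> bval b s \<Longrightarrow> run K d s Q"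
  shows "run K (If b c d) s Q"
proof (cases "bval b s")
  case True
  then obtain t s' where "exec c s t s'" "t \<le> cost K c" "Q s'"
    using assms(1) unfolding run_def by blast
  with True show ?thesis unfolding run_def
    by (intro exI[of _ "t + 1"] exI[of _ s']) (auto intro: exec.IfTrue[simplified])
next
  case False
  then obtain t s' where "exec d s t s'" "t \<le> cost K d" "Q s'"
    using assms(2) unfolding run_def by blast
  with False show ?thesis unfolding run_def
    by (intro exI[of _ "t + 1"] exI[of _ s']) (auto intro: exec.IfFalse[simplified])
qed

abbreviation var :: "string \<Rightarrow> nexp" where
  "var a \<equiv> NRead a (NConst 0) (NConst 0)"

abbreviation arr :: "string \<Rightarrow> nexp \<Rightarrow> nexp" where
  "arr a e \<equiv> NRead a e (NConst 0)"

abbreviation set_var :: "string \<Rightarrow> nexp \<Rightarrow> com" where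
  "set_var a x \<equiv> NAssign a (NConst 0) (NConst 0) x"

abbreviation set_arr :: "string \<Rightarrow> nexp \<Rightarrow> nexp \<Rightarrow> com" where
  "set_arr a e x \<equiv> NAssign a e (NConst 0) x"

text \<open>The counter is raised before the body runs, so the body sees the values from
  \<open>1\<close> to the limit, matching the numbering of agents and goods.\<close>

definition For :: "string \<Rightarrow> string \<Rightarrow> com \<Rightarrow> com" where
  "For x y c = Seq (set_var x (NConst 0))
     (While (NLess (var x) (var y)) (Seq (set_var x (NAdd (var x) (NConst 1))) c))"

lemma writes_For [simp]: "writes (For x y c) = insert x (writes c)"
  by (simp add: For_def)

text \<open>The invariant has to ignore the counter, which the loop itself overwrites. Relating
  every intermediate state to the initial \<open>s\<close> by \<open>unchanged\<close> spares the
  invariants all facts about untouched arrays.\<close>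

lemma run_For:
  fixes I :: "nat \<Rightarrow> state \<Rightarrow> bool"
  assumes N: "fst s (y, 0, 0) = N" "N \<le> K" and "x \<noteq> y" "x \<notin> writes c" "y \<notin> writes c"
    and x_irrelevant: "\<And>k r j. I k r \<Longrightarrow> I k ((fst r)((x, 0, 0) := j), snd r)"
    and init: "I 0 s"
    and step: "\<And>k r. k < N \<Longrightarrow> I k r \<Longrightarrow> fst r (x, 0, 0) = Suc k \<Longrightarrow>
      unchanged (insert x (writes c)) s r \<Longrightarrow> run K c r (I (Suc k))"
    and final: "\<And>r. I N r \<Longrightarrow> unchanged (insert x (writes c)) s r \<Longrightarrow> Q r"
  shows "run K (For x y c) s Q"
proof -
  let ?inc = "set_var x (NAdd (var x) (NConst 1))"
  let ?W = "While (NLess (var x) (var y)) (Seq ?inc c)"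
  \<comment> \<open>Induction on the number \<open>d\<close> of rounds left; a round costs one test,
    one increment and the body, hence \<open>cost K c + 2\<close>.\<close>
  have loop: "\<exists>t r'. exec ?W r t r' \<and> t \<le> 1 + d * (cost K c + 2) \<and> I N r' \<and>
      unchanged (insert x (writes c)) s r'"
    if "I k r" "fst r (x, 0, 0) = k" "unchanged (insert x (writes c)) s r" "k + d = N" for d k r
    using that
  proof (induction d arbitrary: k r)
    case 0
    have "fst r (y, 0, 0) = N" using unchangedD(1)[OF "0.prems"(3), of y] assms by auto
    then have "exec ?W r 1 r" using 0 by (intro exec.WhileFalse) auto
    moreover have "I N r" using 0 by simp
    ultimately show ?case using 0(3) by (intro exI[of _ 1] exI[of _ r]) simp
  next
    case (Suc d)
    let ?r = "((fst r)((x, 0, 0) := Suc k), snd r)"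
    have y: "fst r (y, 0, 0) = N" using unchangedD(1)[OF Suc.prems(3), of y] assms by auto
    have un: "unchanged (insert x (writes c)) s ?r"
      using Suc.prems(3) by (simp add: unchanged_def)
    have inc: "exec ?inc r 1 ?r"
      using exec.NAssign[of x "NConst 0" "NConst 0" "NAdd (var x) (NConst 1)" r] Suc.prems(2) by simp
    have "run K c ?r (I (Suc k))"
      using step[OF _ x_irrelevant[OF Suc.prems(1)] _ un] Suc.prems by auto
    then obtain t r' where c: "exec c ?r t r'" "t \<le> cost K c" "I (Suc k) r'"
      unfolding run_def by blast
    have un_c: "unchanged (writes c) ?r r'" by (rule exec_unchanged[OF c(1)])
    have "fst r' (x, 0, 0) = Suc k" using unchangedD(1)[OF un_c \<open>x \<notin> writes c\<close>] by simp
    moreover have un': "unchanged (insert x (writes c)) s r'"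
      by (rule unchanged_trans[OF un un_c]) auto
    ultimately obtain t' r'' where w: "exec ?W r' t' r''" "t' \<le> 1 + d * (cost K c + 2)" "I N r''"
        "unchanged (insert x (writes c)) s r''"
      using Suc.IH[OF c(3)] Suc.prems(4) by auto
    have "exec ?W r ((1 + t) + t' + 1) r''"
      using y Suc.prems by (intro exec.WhileTrue[OF _ exec.Seq[OF inc c(1)] w(1)]) auto
    then show ?case using c(2) w(2-) by (intro exI[of _ "(1 + t) + t' + 1"] exI[of _ r'']) auto
  qed
  let ?s = "((fst s)((x, 0, 0) := 0), snd s)"
  have init': "exec (set_var x (NConst 0)) s 1 ?s"
    using exec.NAssign[of x "NConst 0" "NConst 0" "NConst 0" s] by simp
  obtain t r where r: "exec ?W ?s t r" "t \<le> 1 + N * (cost K c + 2)" "I N r"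
      "unchanged (insert x (writes c)) s r"
    using loop[of 0 ?s N] x_irrelevant[OF init] by (auto simp: unchanged_def)
  have "exec (For x y c) s (1 + t) r" unfolding For_def by (rule exec.Seq[OF init' r(1)])
  moreover have "1 + t \<le> cost K (For x y c)"
    using r(2) mult_le_mono1[OF N(2), of "cost K c + 2"] by (simp add: For_def)
  ultimately show ?thesis using final r(3,4) unfolding run_def by blast
qed


section \<open>Envy cycles\<close>

text \<open>The utility \<open>u\<close> of agent and bundle number is abstract, so that the raw
  contents of the program's table can be used for it.\<close>

definition envy :: "nat \<Rightarrow> (nat \<Rightarrow> nat \<Rightarrow> real) \<Rightarrow> (nat \<Rightarrow> nat) \<Rightarrow> nat" where
  "envy n u h = (\<Sum>i\<in>{1..n}. card {b \<in> {1..n}. u i (h i) < u i b})"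

text \<open>An agent's own bundle is not among those it prefers, so at most \<open>n - 1\<close>
  bundles count per agent. The strictness is what rules out \<open>n * n\<close> rounds without a
  source.\<close>

lemma envy_bound:
  assumes "n \<ge> 1" "h ` {1..n} \<subseteq> {1..n}"
  shows "envy n u h < n * n"
proof -
  have "card {b \<in> {1..n}. u i (h i) < u i b} < card {1..n}" if "i \<in> {1..n}" for i
  proof (rule psubset_card_mono)
    have "h i \<in> {1..n}" using that assms by blast
    then show "{b \<in> {1..n}. u i (h i) < u i b} \<subset> {1..n}" by blast
  qed simp
  then have "envy n u h < (\<Sum>i\<in>{1..n}. n)"
    unfolding envy_def using assms by (intro sum_strict_mono) auto
  then show ?thesis by simp
qed

text \<open>Sets of preferred bundles can only shrink when own values rise, and the set of
  \<open>x\<close> loses its new bundle \<open>h' x\<close>.\<close>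

lemma envy_decreases:
  assumes le: "\<And>i. i \<in> {1..n} \<Longrightarrow> u i (h i) \<le> u i (h' i)"
    and x: "x \<in> {1..n}" "u x (h x) < u x (h' x)" "h' x \<in> {1..n}"
  shows "envy n u h' < envy n u h"
  unfolding envy_def
proof (rule sum_strict_mono_ex1)
  have sub: "{b \<in> {1..n}. u i (h' i) < u i b} \<subseteq> {b \<in> {1..n}. u i (h i) < u i b}"
    if "i \<in> {1..n}" for i
    using le[OF that] by fastforce
  show "\<forall>i\<in>{1..n}. card {b \<in> {1..n}. u i (h' i) < u i b} \<le> card {b \<in> {1..n}. u i (h i) < u i b}"
    using sub by (intro ballI card_mono) simp_all
  have "h' x \<in> {b \<in> {1..n}. u x (h x) < u x b} - {b \<in> {1..n}. u x (h' x) < u x b}"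
    using x by simp
  then have "{b \<in> {1..n}. u x (h' x) < u x b} \<subset> {b \<in> {1..n}. u x (h x) < u x b}"
    using sub[OF x(1)] by blast
  then have "card {b \<in> {1..n}. u x (h' x) < u x b} < card {b \<in> {1..n}. u x (h x) < u x b}"
    by (intro psubset_card_mono) simp_all
  then show "\<exists>i\<in>{1..n}. card {b \<in> {1..n}. u i (h' i) < u i b} < card {b \<in> {1..n}. u i (h i) < u i b}"
    using x(1) by blast
qed simp

section \<open>Cycles of a self-map of the agents\<close>

lemma funpow_in: "p ` A \<subseteq> A \<Longrightarrow> a \<in> A \<Longrightarrow> (p ^^ j) a \<in> A"
  by (induction j) auto

text \<open>Pigeonhole: two of the \<open>n + 1\<close> iterates of \<open>a\<close> coincide, and
  applying \<open>p\<close> further moves the coincidence to the fixed index \<open>n\<close>. So a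
  walk of exactly \<open>n\<close> steps ends on a cycle, wherever it enters one.\<close>

lemma funpow_reaches_cycle:
  fixes p :: "nat \<Rightarrow> nat"
  assumes "p ` {1..n} \<subseteq> {1..n}" "a \<in> {1..n}"
  obtains k where "0 < k" "k \<le> n" "(p ^^ k) ((p ^^ n) a) = (p ^^ n) a"
proof -
  have "card ((\<lambda>j. (p ^^ j) a) ` {0..n}) \<le> card {1..n}"
    using funpow_in[OF assms] by (intro card_mono) auto
  then have "\<not> inj_on (\<lambda>j. (p ^^ j) a) {0..n}" using card_image by fastforce
  then obtain i j where ij: "i < j" "j \<le> n" "(p ^^ i) a = (p ^^ j) a"
    unfolding inj_on_def by (metis atLeastAtMost_iff nat_neq_iff)
  have shift: "(p ^^ l) ((p ^^ r) a) = (p ^^ (l + r)) a" for l r by (simp only: funpow_add comp_apply)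
  have "j - i + n = n - i + j" "n - i + i = n" using ij by auto
  then have "(p ^^ (j - i)) ((p ^^ n) a) = (p ^^ (n - i)) ((p ^^ j) a)" by (simp only: shift)
  also have "\<dots> = (p ^^ n) a"
    using \<open>n - i + i = n\<close> by (simp only: shift flip: ij(3))
  finally show thesis using that[of "j - i"] ij by auto
qed

text \<open>A repetition could be pushed forward by \<open>k - j\<close> steps and would bring
  \<open>x\<close> back after \<open>k - j + i\<close> steps, which is too early.\<close>

lemma funpow_cycle_inj:
  assumes "(p ^^ k) x = x" "\<And>j. 0 < j \<Longrightarrow> j < k \<Longrightarrow> (p ^^ j) x \<noteq> x" "i < j" "j < k"
  shows "(p ^^ i) x \<noteq> (p ^^ j) x"
proof
  assume eq: "(p ^^ i) x = (p ^^ j) x"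
  have "(p ^^ (k - j + i)) x = (p ^^ (k - j)) ((p ^^ j) x)" by (simp only: funpow_add comp_apply eq)
  also have "\<dots> = (p ^^ (k - j + j)) x" by (simp only: funpow_add comp_apply)
  also have "\<dots> = x" using assms by simp
  finally have "(p ^^ (k - j + i)) x = x" .
  moreover have "(p ^^ (k - j + i)) x \<noteq> x" by (rule assms(2)) (use assms(3,4) in auto)
  ultimately show False by contradiction
qed

text \<open>\<open>h'\<close> arises from \<open>h\<close> after \<open>t\<close> swaps with \<open>x\<close> along the cycle \<open>x, p x, \<dots>, (p ^^ k) x = x\<close>;
  meanwhile \<open>x\<close> holds the bundle to be handed over next, which may be worse than its own.\<close>

definition rotation ::
  "nat \<Rightarrow> (nat \<Rightarrow> nat \<Rightarrow> real) \<Rightarrow> (nat \<Rightarrow> nat) \<Rightarrow> (nat \<Rightarrow> nat) \<Rightarrow> nat \<Rightarrow> nat \<Rightarrow> nat \<Rightarrow> (nat \<Rightarrow> nat) \<Rightarrow> bool" where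
  "rotation n u h p x k t h' \<longleftrightarrow>
     inj_on h' {1..n} \<and> h' ` {1..n} \<subseteq> {1..n} \<and>
     (\<forall>i\<in>{1..n} - {x}. u i (h i) \<le> u i (h' i)) \<and>
     h' x = h ((p ^^ t) x) \<and> (\<forall>j. t < j \<longrightarrow> j < k \<longrightarrow> h' ((p ^^ j) x) = h ((p ^^ j) x))"

lemma rotation_0:
  "inj_on h {1..n} \<Longrightarrow> h ` {1..n} \<subseteq> {1..n} \<Longrightarrow> rotation n u h p x k 0 h"
  by (simp add: rotation_def)

text \<open>The agent \<open>y\<close> envies \<open>(p ^^ t) x\<close>, whose old bundle
  \<open>x\<close> currently holds: the swap gives \<open>y\<close> what it covets and leaves
  \<open>x\<close> with the bundle due to the next agent.\<close>

lemma rotation_Suc: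
  assumes rot: "rotation n u h p x k t h'" and t: "Suc t < k"
    and p: "p ` {1..n} \<subseteq> {1..n}" "\<And>y. y \<in> {1..n} \<Longrightarrow> u (p y) (h (p y)) < u (p y) (h y)"
    and x: "x \<in> {1..n}" "(p ^^ k) x = x" "\<And>j. 0 < j \<Longrightarrow> j < k \<Longrightarrow> (p ^^ j) x \<noteq> x"
    and y: "y = (p ^^ Suc t) x"
  shows "rotation n u h p x k (Suc t) (h'(x := h' y, y := h' x))"
proof -
  have xt: "(p ^^ t) x \<in> {1..n}" and yn: "y \<in> {1..n}" using funpow_in[OF p(1) x(1)] y by blast+
  have yx: "y \<noteq> x" using x(3)[of "Suc t"] t y by simp
  have h'x: "h' x = h ((p ^^ t) x)" using rot by (simp add: rotation_def)
  have "\<forall>j. t < j \<longrightarrow> j < k \<longrightarrow> h' ((p ^^ j) x) = h ((p ^^ j) x)"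
    using rot unfolding rotation_def by blast
  then have h'y: "h' y = h y" using t unfolding y by blast
  \<comment> \<open>The swap is composition with a transposition, from which injectivity and range
    follow.\<close>
  let ?\<tau> = "\<lambda>i. if i = x then y else if i = y then x else i"
  have swap: "h'(x := h' y, y := h' x) = h' \<circ> ?\<tau>" using yx by (simp add: fun_eq_iff)
  have inj: "inj_on ?\<tau> {1..n}" by (rule inj_onI) (auto split: if_splits)
  have \<tau>: "?\<tau> ` {1..n} \<subseteq> {1..n}" using x(1) yn by auto
  have h': "inj_on h' {1..n}" "h' ` {1..n} \<subseteq> {1..n}" using rot unfolding rotation_def by blast+
  have "inj_on (h'(x := h' y, y := h' x)) {1..n}"
    unfolding swap by (rule comp_inj_on[OF inj inj_on_subset[OF h'(1) \<tau>]])
  moreover have "(h'(x := h' y, y := h' x)) ` {1..n} \<subseteq> {1..n}"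
    unfolding swap image_comp[symmetric] using h'(2) \<tau> by blast
  moreover have "u y (h y) < u y (h ((p ^^ t) x))" using p(2)[OF xt] y by simp
  then have "\<forall>i\<in>{1..n} - {x}. u i (h i) \<le> u i ((h'(x := h' y, y := h' x)) i)"
    using rot h'x yx by (simp add: rotation_def)
  moreover have "(h'(x := h' y, y := h' x)) x = h ((p ^^ Suc t) x)" using yx h'y y by simp
  moreover have "(h'(x := h' y, y := h' x)) ((p ^^ j) x) = h ((p ^^ j) x)" if "Suc t < j" "j < k" for j
  proof -
    have "(p ^^ j) x \<noteq> y" using funpow_cycle_inj[OF x(2,3) that] y by metis
    moreover have "(p ^^ j) x \<noteq> x" using x(3) that by auto
    ultimately show ?thesis using rot that by (simp add: rotation_def)
  qed
  ultimately show ?thesis unfolding rotation_def by blast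
qed

text \<open>After \<open>k - 1\<close> swaps \<open>x\<close> holds the old bundle of its
  predecessor on the cycle, whose chosen envier is \<open>x\<close> itself; so \<open>x\<close>
  gains as well, and no further swap is due.\<close>

lemma rotation_end:
  assumes "rotation n u h p x k (k - 1) h'" "0 < k" "p ` {1..n} \<subseteq> {1..n}" "x \<in> {1..n}"
    and "\<And>y. y \<in> {1..n} \<Longrightarrow> u (p y) (h (p y)) < u (p y) (h y)" "(p ^^ k) x = x"
  shows "u x (h x) < u x (h' x)" and "\<And>i. i \<in> {1..n} \<Longrightarrow> u i (h i) \<le> u i (h' i)"
proof -
  let ?z = "(p ^^ (k - 1)) x"
  have "p ?z = x" using assms(2,6) by (cases k) auto
  moreover have "h' x = h ?z" using assms(1) by (simp add: rotation_def)
  ultimately show less: "u x (h x) < u x (h' x)"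
    using assms(5)[OF funpow_in[OF assms(3,4)], of "k - 1"] by simp
  show "u i (h i) \<le> u i (h' i)" if "i \<in> {1..n}" for i
    using assms(1) less that by (cases "i = x") (auto simp: rotation_def)
qed


section \<open>The invariant of the allocation\<close>

locale bounded_instance =
  fixes n m :: nat and v :: "nat \<Rightarrow> nat set \<Rightarrow> real"
  assumes inst: "fair_division_instance n m v"
    and half: "range_parameter n m v \<ge> 1 / 2"
begin

lemma n_pos: "n \<ge> 1"
  and additive: "i \<in> {1..n} \<Longrightarrow> S \<subseteq> {1..m} \<Longrightarrow> v i S = (\<Sum>g\<in>S. v i {g})"
  and nonneg: "i \<in> {1..n} \<Longrightarrow> S \<subseteq> {1..m} \<Longrightarrow> v i S \<ge> 0"
  and valued: "g \<in> {1..m} \<Longrightarrow> \<exists>i\<in>{1..n}. v i {g} > 0"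
proof -
  note inst' = inst[unfolded fair_division_instance_def]
  show "n \<ge> 1" using inst' by (rule conjunct1)
  have *: "\<forall>i\<in>{1..n}. \<forall>S. S \<subseteq> {1..m} \<longrightarrow> v i S \<ge> 0 \<and> v i S = (\<Sum>g\<in>S. v i {g})"
    using inst' by (elim conjE)
  show "v i S = (\<Sum>g\<in>S. v i {g})" if "i \<in> {1..n}" "S \<subseteq> {1..m}" using * that by blast
  show "v i S \<ge> 0" if "i \<in> {1..n}" "S \<subseteq> {1..m}" using * that by blast
  have "\<forall>g\<in>{1..m}. \<exists>i\<in>{1..n}. v i {g} > 0" using inst' by (elim conjE)
  then show "\<exists>i\<in>{1..n}. v i {g} > 0" if "g \<in> {1..m}" using that by (rule bspec)
qed

lemma v_insert:
  assumes "i \<in> {1..n}" "S \<subseteq> {1..m}" "g \<in> {1..m}" "g \<notin> S"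
  shows "v i (insert g S) = v i {g} + v i S"
proof -
  have "finite S" using assms(2) finite_subset by blast
  then show ?thesis using assms additive[of i S] additive[of i "insert g S"] by simp
qed

definition peak :: "nat \<Rightarrow> real" where
  "peak g = Max ((\<lambda>i. v i {g}) ` {1..n})"

lemma le_peak: "i \<in> {1..n} \<Longrightarrow> v i {g} \<le> peak g"
  unfolding peak_def by (intro Max_ge) auto

lemma peak_le: "(\<And>i. i \<in> {1..n} \<Longrightarrow> v i {g} \<le> c) \<Longrightarrow> peak g \<le> c"
  unfolding peak_def using n_pos by (subst Max_le_iff) auto

text \<open>The one place where the range parameter enters: the minimum in \<open>good_range\<close>
  is over the agents that value \<open>g\<close>, so it is at most the value for such an
  \<open>i\<close>.\<close>

lemma peak_le_twice:
  assumes "i \<in> {1..n}" "g \<in> {1..m}" "v i {g} > 0"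
  shows "peak g \<le> 2 * v i {g}"
proof -
  have "peak g > 0" using le_peak[OF assms(1), of g] assms(3) by linarith
  have "range_parameter n m v \<le> good_range n v g"
    unfolding range_parameter_def using assms(2) by (intro Min_le) auto
  with half have "1 / 2 \<le> good_range n v g" by linarith
  also have "\<dots> \<le> v i {g} / peak g"
    unfolding good_range_def peak_def[symmetric]
    using assms \<open>peak g > 0\<close> by (intro divide_right_mono Min_le) auto
  finally show ?thesis using \<open>peak g > 0\<close> by (simp add: field_simps)
qed

definition contents :: "(nat \<Rightarrow> nat) \<Rightarrow> nat \<Rightarrow> nat set" where
  "contents B b = {g \<in> {1..m}. B g = b}"

lemma contents_subset: "contents B b \<subseteq> {1..m}"
  by (auto simp: contents_def)

text \<open>\<open>B\<close> assigns goods to bundles, with \<open>0\<close> for goods not yet assigned, and \<open>h i\<close> is the bundle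
  held by agent \<open>i\<close>.\<close>

definition valid :: "(nat \<Rightarrow> nat) \<Rightarrow> (nat \<Rightarrow> nat) \<Rightarrow> bool" where
  "valid B h \<longleftrightarrow>
     inj_on h {1..n} \<and> h ` {1..n} \<subseteq> {1..n} \<and> (\<forall>g\<in>{1..m}. B g \<le> n) \<and>
     (\<forall>g\<in>{1..m}. \<forall>g'\<in>{1..m}. B g \<noteq> 0 \<longrightarrow> B g' = 0 \<longrightarrow> peak g' \<le> peak g) \<and>
     (\<forall>i\<in>{1..n}. \<forall>b\<in>{1..n}. \<forall>g\<in>contents B b. v i {g} > 0 \<longrightarrow>
        v i (contents B b) \<le> v i (contents B (h i)) + peak g)"

lemma
  assumes "valid B h"
  shows valid_inj: "inj_on h {1..n}"
    and valid_image: "h ` {1..n} \<subseteq> {1..n}"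
    and valid_le: "g \<in> {1..m} \<Longrightarrow> B g \<le> n"
    and valid_order: "g \<in> {1..m} \<Longrightarrow> g' \<in> {1..m} \<Longrightarrow> B g \<noteq> 0 \<Longrightarrow> B g' = 0 \<Longrightarrow> peak g' \<le> peak g"
    and valid_bound: "i \<in> {1..n} \<Longrightarrow> b \<in> {1..n} \<Longrightarrow> g \<in> contents B b \<Longrightarrow> v i {g} > 0 \<Longrightarrow>
      v i (contents B b) \<le> v i (contents B (h i)) + peak g"
  using assms unfolding valid_def by blast+

lemma valid_holds: "valid B h \<Longrightarrow> i \<in> {1..n} \<Longrightarrow> h i \<in> {1..n}"
  using valid_image by blast

lemma valid_surj:
  assumes "valid B h" "b \<in> {1..n}"
  obtains i where "i \<in> {1..n}" "h i = b"
proof -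
  have "h ` {1..n} = {1..n}" using assms(1) by (intro endo_inj_surj valid_image valid_inj) simp
  then show thesis using assms(2) that by (metis imageE)
qed

text \<open>The bound in \<open>valid\<close> ranges over bundles, not over their holders, so
  changing \<open>h\<close> affects only the value of the agent's own bundle, which does not
  fall.\<close>

lemma valid_improve:
  assumes "valid B h" "inj_on h' {1..n}" "h' ` {1..n} \<subseteq> {1..n}"
    and "\<And>i. i \<in> {1..n} \<Longrightarrow> v i (contents B (h i)) \<le> v i (contents B (h' i))"
  shows "valid B h'"
  unfolding valid_def
proof (intro conjI ballI impI assms(2,3))
  fix i b g assume *: "i \<in> {1..n}" "b \<in> {1..n}" "g \<in> contents B b" "v i {g} > 0"
  then have "v i (contents B b) \<le> v i (contents B (h i)) + peak g" by (rule valid_bound[OF assms(1)])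
  then show "v i (contents B b) \<le> v i (contents B (h' i)) + peak g" using assms(4)[OF *(1)] by simp
qed (use valid_le[OF assms(1)] valid_order[OF assms(1)] in simp_all)

text \<open>The second conclusion is the update that the program applies to its table of bundle
  values.\<close>

lemma valid_give:
  assumes valid: "valid B h" and c: "c \<in> {1..m}" "B c = 0"
    and best: "\<And>g. g \<in> {1..m} \<Longrightarrow> B g = 0 \<Longrightarrow> peak g \<le> peak c"
    and x: "x \<in> {1..n}"
    and unenvied: "\<And>i. i \<in> {1..n} \<Longrightarrow> v i (contents B (h x)) \<le> v i (contents B (h i))"
  shows "valid (B(c := h x)) h"
    and "\<And>i b. i \<in> {1..n} \<Longrightarrow> b \<in> {1..n} \<Longrightarrow>
      v i (contents (B(c := h x)) b) = v i (contents B b) + (if b = h x then v i {c} else 0)"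
proof -
  let ?B = "B(c := h x)"
  have hx: "h x \<in> {1..n}" by (rule valid_holds[OF valid x])
  have eq: "contents ?B b = (if b = h x then insert c (contents B b) else contents B b)" if "b \<in> {1..n}" for b
    using that c hx by (auto simp: contents_def)
  have "c \<notin> contents B (h x)" using c hx by (auto simp: contents_def)
  then show vB: "v i (contents ?B b) = v i (contents B b) + (if b = h x then v i {c} else 0)"
    if "i \<in> {1..n}" "b \<in> {1..n}" for i b
    using that c v_insert[OF that(1) contents_subset] by (simp add: eq)
  have "v i (contents ?B b) \<le> v i (contents ?B (h i)) + peak g"
    if i: "i \<in> {1..n}" and b: "b \<in> {1..n}" and g: "g \<in> contents ?B b" "v i {g} > 0" for i b g
  proof -
    have hi: "h i \<in> {1..n}" by (rule valid_holds[OF valid i])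
    have ge: "v i (contents B (h i)) \<le> v i (contents ?B (h i))"
      using vB[OF i hi] nonneg[OF i, of "{c}"] c by simp
    show ?thesis
    proof (cases "b = h x")
      case True
      \<comment> \<open>In \<open>B\<close> the good \<open>c\<close> is still free, so the order
        part of \<open>valid\<close> puts the peaks of all goods already in the bundle at or above
        that of \<open>c\<close>.\<close>
      have "peak c \<le> peak g"
      proof (cases "g = c")
        case False
        then have "g \<in> {1..m}" "B g \<noteq> 0" using g(1) b by (auto simp: contents_def)
        then show ?thesis using valid_order[OF valid] c by blast
      qed simp
      moreover have "v i {c} \<le> peak c" by (rule le_peak[OF i])
      ultimately show ?thesis using vB[OF i b] unenvied[OF i] ge True by simp
    next
      case False
      then have "g \<in> contents B b" using g eq[OF b] by simp
      then have "v i (contents B b) \<le> v i (contents B (h i)) + peak g"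
        by (rule valid_bound[OF valid i b _ g(2)])
      then show ?thesis using ge vB[OF i b] False by simp
    qed
  qed
  moreover have "peak g' \<le> peak g" if "g \<in> {1..m}" "g' \<in> {1..m}" "?B g \<noteq> 0" "?B g' = 0" for g g'
    using that best valid_order[OF valid that(1,2)] hx by (cases "g = c"; cases "g' = c") simp_all
  moreover have "?B g \<le> n" if "g \<in> {1..m}" for g
    using valid_le[OF valid that] hx by simp
  ultimately show "valid ?B h"
    unfolding valid_def by (intro conjI ballI impI valid_inj[OF valid] valid_image[OF valid])
qed

text \<open>\<open>w\<close> picks for each good a holder of its bundle. As \<open>h\<close> is
  injective there is just one, so the goods of agent \<open>i\<close> are exactly the contents of
  bundle \<open>h i\<close>.\<close>

lemma valid_complete:
  assumes valid: "valid B h" and B: "\<And>g. g \<in> {1..m} \<Longrightarrow> B g \<noteq> 0"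
    and w: "\<And>g. g \<in> {1..m} \<Longrightarrow> w g \<in> {1..n} \<and> h (w g) = B g"
  shows "allocation n m (\<lambda>i. {g \<in> {1..m}. w g = i})" and "tEFx n m v (\<lambda>i. {g \<in> {1..m}. w g = i})"
proof -
  let ?A = "\<lambda>i. {g \<in> {1..m}. w g = i}"
  show "allocation n m ?A" using w by (auto simp: allocation_def)
  have A: "?A i = contents B (h i)" if i: "i \<in> {1..n}" for i
    unfolding contents_def
  proof (intro Collect_cong conj_cong refl)
    fix g assume "g \<in> {1..m}"
    then have "w g \<in> {1..n}" "h (w g) = B g" using w by blast+
    then show "w g = i \<longleftrightarrow> B g = h i" using inj_onD[OF valid_inj[OF valid], of "w g" i] i by auto
  qed
  have "v i (?A j - {g}) \<le> v i (?A i \<union> {g})"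
    if i: "i \<in> {1..n}" and j: "j \<in> {1..n}" and g: "g \<in> ?A j" "g \<in> positive_goods m v i" for i j g
  proof -
    have pos: "g \<in> {1..m}" "v i {g} > 0" using g by (auto simp: positive_goods_def)
    have "v i (insert g (?A j - {g})) = v i {g} + v i (?A j - {g})"
      by (rule v_insert[OF i]) (use pos in auto)
    moreover have "insert g (?A j - {g}) = ?A j" using g by auto
    ultimately have Aj: "v i (?A j) = v i {g} + v i (?A j - {g})" by simp
    show ?thesis
    proof (cases "i = j")
      case True
      then have "?A i \<union> {g} = ?A j" using g by auto
      then show ?thesis using Aj pos by simp
    next
      case False
      have "v i (insert g (?A i)) = v i {g} + v i (?A i)"
        by (rule v_insert[OF i]) (use pos g False in auto)
      moreover have "v i (?A j) \<le> v i (?A i) + peak g"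
        using valid_bound[OF valid i valid_holds[OF valid j] _ pos(2)] g(1) unfolding A[OF i] A[OF j] .
      ultimately show ?thesis using Aj peak_le_twice[OF i pos] by simp
    qed
  qed
  then show "tEFx n m v ?A" unfolding tEFx_def by blast
qed

end


section \<open>The program\<close>

text \<open>Arrays: \<open>bun\<close> maps goods to bundles (\<open>0\<close> if not yet assigned), \<open>h\<close> agents to the bundles they
  hold, and \<open>val\<close> has the values of the bundles. \<open>p\<close> maps an agent to one that envies it (\<open>0\<close> if
  there is none), and \<open>src\<close> is an agent that nobody envies (\<open>0\<close> if none has been found).\<close>

definition test_good :: com where
  "test_good = If (And (NEq (arr ''bun'' (var ''g'')) (NConst 0))
       (RLess (RRead ''best'' (NConst 0) (NConst 0)) (RRead ''v'' (var ''i'') (var ''g''))))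
     (Seq (RAssign ''best'' (NConst 0) (NConst 0) (RRead ''v'' (var ''i'') (var ''g'')))
       (set_var ''cur'' (var ''g'')))
     Skip"

text \<open>No peaks are computed: the largest value over all pairs of an agent and a free good is
  attained at a free good of maximal peak.\<close>

definition select_good :: com where
  "select_good = Seq (RAssign ''best'' (NConst 0) (NConst 0) (RConst 0))
     (For ''i'' ''n'' (For ''g'' ''m'' test_good))"

definition test_envier :: com where
  "test_envier = If (RLess (RRead ''val'' (var ''z'') (arr ''h'' (var ''z'')))
       (RRead ''val'' (var ''z'') (arr ''h'' (var ''y''))))
     (set_arr ''p'' (var ''y'') (var ''z'')) Skip"

definition find_envier :: com where
  "find_envier = Seq (set_arr ''p'' (var ''y'') (NConst 0))
     (Seq (For ''z'' ''n'' test_envier)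
       (If (NEq (arr ''p'' (var ''y'')) (NConst 0)) (set_var ''src'' (var ''y'')) Skip))"

definition walk :: com where
  "walk = Seq (set_var ''x'' (NConst 1)) (For ''k'' ''n'' (set_var ''x'' (arr ''p'' (var ''x''))))"

text \<open>Once \<open>y\<close> has come round to \<open>x\<close> nothing is done, so the loop
  can run \<open>n\<close> times although the cycle may be shorter.\<close>

definition swap_holders :: com where
  "swap_holders = If (NEq (var ''x'') (var ''y'')) Skip
     (Seq (set_var ''t'' (arr ''h'' (var ''x'')))
       (Seq (set_arr ''h'' (var ''x'') (arr ''h'' (var ''y'')))
         (Seq (set_arr ''h'' (var ''y'') (var ''t''))
           (set_var ''y'' (arr ''p'' (var ''y''))))))"

definition rotate_cycle :: com where
  "rotate_cycle = Seq (set_var ''y'' (arr ''p'' (var ''x''))) (For ''k'' ''n'' swap_holders)"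

definition improve :: com where
  "improve = If (NEq (var ''src'') (NConst 0))
     (Seq (For ''y'' ''n'' find_envier)
       (If (NEq (var ''src'') (NConst 0)) (Seq walk rotate_cycle) Skip))
     Skip"

text \<open>The language has no multiplication; nesting two loops yields the \<open>n * n\<close>
  rounds.\<close>

definition find_source :: com where
  "find_source = Seq (set_var ''src'' (NConst 0)) (For ''a'' ''n'' (For ''e'' ''n'' improve))"

definition add_value :: com where
  "add_value = RAssign ''val'' (var ''i'') (var ''t'')
     (RAdd (RRead ''val'' (var ''i'') (var ''t'')) (RRead ''v'' (var ''i'') (var ''cur'')))"

definition give_good :: com where
  "give_good = Seq (set_var ''t'' (arr ''h'' (var ''src'')))
     (Seq (set_arr ''bun'' (var ''cur'') (var ''t'')) (For ''i'' ''n'' add_value))"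

definition allocate_good :: com where
  "allocate_good = Seq select_good (Seq find_source give_good)"

text \<open>Owners are read off only at the end, since rotations pass bundles on to other
  agents.\<close>

definition test_owner :: com where
  "test_owner = If (NEq (arr ''h'' (var ''i'')) (arr ''bun'' (var ''g'')))
     (set_arr ''owner'' (var ''g'') (var ''i'')) Skip"

definition tEFx_program :: com where
  "tEFx_program = Seq (For ''i'' ''n'' (set_arr ''h'' (var ''i'') (var ''i'')))
     (Seq (For ''r'' ''m'' allocate_good) (For ''g'' ''m'' (For ''i'' ''n'' test_owner)))"

lemma writes_bodies [simp]:
  "writes test_good = {''best'', ''cur''}" "writes test_envier = {''p''}"
  "writes swap_holders = {''t'', ''h'', ''y''}" "writes add_value = {''val''}"
  "writes test_owner = {''owner''}"
  by (auto simp: test_good_def test_envier_def swap_holders_def add_value_def test_owner_def)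

lemma writes_parts [simp]:
  "writes select_good = {''best'', ''i'', ''g'', ''cur''}"
  "writes find_envier = {''p'', ''z'', ''src''}"
  "writes walk = {''x'', ''k''}"
  "writes rotate_cycle = {''y'', ''k'', ''t'', ''h''}"
  "writes give_good = {''t'', ''bun'', ''i'', ''val''}"
  by (auto simp: select_good_def find_envier_def walk_def rotate_cycle_def give_good_def)

lemma writes_improve [simp]:
  "writes improve = {''y'', ''p'', ''z'', ''src'', ''x'', ''k'', ''t'', ''h''}"
  by (auto simp: improve_def)

lemma writes_find_source [simp]: "writes find_source = insert ''a'' (insert ''e'' (writes improve))"
  by (auto simp: find_source_def)

lemma writes_allocate_good [simp]:
  "writes allocate_good = writes select_good \<union> (writes find_source \<union> writes give_good)"
  by (simp add: allocate_good_def)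

section \<open>Correctness of the search for an unenvied agent\<close>

definition envier ::
  "(nat \<Rightarrow> nat \<Rightarrow> real) \<Rightarrow> (nat \<Rightarrow> nat) \<Rightarrow> nat set \<Rightarrow> nat \<Rightarrow> nat \<Rightarrow> bool" where
  "envier u h S y q \<longleftrightarrow>
     (if q = 0 then \<forall>z\<in>S. u z (h y) \<le> u z (h z) else q \<in> S \<and> u q (h q) < u q (h y))"

lemma envier_Suc:
  assumes "envier u h {1..l} y q"
  shows "envier u h {1..Suc l} y (if u (Suc l) (h (Suc l)) < u (Suc l) (h y) then Suc l else q)"
  using assms by (auto simp: envier_def le_Suc_eq)

lemma run_test_envier:
  assumes s: "fst s (''y'', 0, 0) = y" "fst s (''z'', 0, 0) = Suc l"
    and u: "\<And>i b. snd s (''val'', i, b) = u i b" and h: "\<And>i. fst s (''h'', i, 0) = h i"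
    and p: "envier u h {1..l} y (fst s (''p'', y, 0))"
  shows "run K test_envier s (\<lambda>r. envier u h {1..Suc l} y (fst r (''p'', y, 0)) \<and>
    (\<forall>i. i \<noteq> y \<longrightarrow> fst r (''p'', i, 0) = fst s (''p'', i, 0)))"
  unfolding test_envier_def
  using envier_Suc[OF p] by (intro run_If run_NAssign run_Skip) (simp_all add: s u h)

lemma run_find_envier:
  assumes n: "fst s (''n'', 0, 0) = n" "n \<le> K" and y: "fst s (''y'', 0, 0) = y"
    and u: "\<And>i b. snd s (''val'', i, b) = u i b" and h: "\<And>i. fst s (''h'', i, 0) = h i"
  shows "run K find_envier s (\<lambda>r. envier u h {1..n} y (fst r (''p'', y, 0)) \<and>
    (\<forall>i. i \<noteq> y \<longrightarrow> fst r (''p'', i, 0) = fst s (''p'', i, 0)) \<and>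
    fst r (''src'', 0, 0) = (if fst r (''p'', y, 0) = 0 then y else fst s (''src'', 0, 0)))"
  unfolding find_envier_def
proof (rule run_Seq', rule run_NAssign)
  let ?s = "((fst s)((''p'', nval (var ''y'') s, nval (NConst 0) s) := nval (NConst 0) s), snd s)"
  define J where "J l q \<longleftrightarrow> envier u h {1..l} y (fst q (''p'', y, 0)) \<and>
    (\<forall>i. i \<noteq> y \<longrightarrow> fst q (''p'', i, 0) = fst s (''p'', i, 0))" for l and q :: state
  have loop: "run K (For ''z'' ''n'' test_envier) ?s (J n)"
  proof (rule run_For[where I = J and N = n])
    fix l q
    assume J: "J l q" and z: "fst q (''z'', 0, 0) = Suc l"
      and un: "unchanged (insert ''z'' (writes test_envier)) ?s q"
    have q: "\<And>i b. snd q (''val'', i, b) = u i b" "\<And>i. fst q (''h'', i, 0) = h i"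
        "fst q (''y'', 0, 0) = y"
      using un u h y by (simp_all add: unchangedD)
    show "run K test_envier q (J (Suc l))"
      by (rule run_conseq[OF run_test_envier[OF q(3) z q(1,2)]]) (use J in \<open>simp_all add: J_def\<close>)
  next
    show "J 0 ?s" using y by (simp add: J_def envier_def)
  qed (use n in \<open>simp_all add: J_def\<close>)
  show "run K (Seq (For ''z'' ''n'' test_envier)
      (If (NEq (arr ''p'' (var ''y'')) (NConst 0)) (set_var ''src'' (var ''y'')) Skip)) ?s
      (\<lambda>r. envier u h {1..n} y (fst r (''p'', y, 0)) \<and>
        (\<forall>i. i \<noteq> y \<longrightarrow> fst r (''p'', i, 0) = fst s (''p'', i, 0)) \<and>
        fst r (''src'', 0, 0) = (if fst r (''p'', y, 0) = 0 then y else fst s (''src'', 0, 0)))"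
  proof (rule run_Seq[OF loop])
    fix q assume J: "J n q" and un: "unchanged (writes (For ''z'' ''n'' test_envier)) ?s q"
    have q: "fst q (''y'', 0, 0) = y" "fst q (''src'', 0, 0) = fst s (''src'', 0, 0)"
      using un y by (simp_all add: unchangedD)
    show "run K (If (NEq (arr ''p'' (var ''y'')) (NConst 0)) (set_var ''src'' (var ''y'')) Skip) q
      (\<lambda>r. envier u h {1..n} y (fst r (''p'', y, 0)) \<and>
        (\<forall>i. i \<noteq> y \<longrightarrow> fst r (''p'', i, 0) = fst s (''p'', i, 0)) \<and>
        fst r (''src'', 0, 0) = (if fst r (''p'', y, 0) = 0 then y else fst s (''src'', 0, 0)))"
      using J by (intro run_If run_NAssign run_Skip) (simp_all add: q J_def)
  qed
qed

text \<open>The mark \<open>0\<close> is available because agents are numbered from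
  \<open>1\<close>. Once a source is known nothing is claimed about \<open>p\<close>, as enviers
  matter only for rotating a cycle.\<close>

definition envy_graph ::
  "nat \<Rightarrow> (nat \<Rightarrow> nat \<Rightarrow> real) \<Rightarrow> (nat \<Rightarrow> nat) \<Rightarrow> nat set \<Rightarrow> (nat \<Rightarrow> nat) \<Rightarrow> nat \<Rightarrow> bool" where
  "envy_graph n u h Y p src \<longleftrightarrow>
     (if src = 0 then \<forall>y\<in>Y. p y \<in> {1..n} \<and> u (p y) (h (p y)) < u (p y) (h y)
      else src \<in> {1..n} \<and> (\<forall>z\<in>{1..n}. u z (h src) \<le> u z (h z)))"

lemma envy_graph_Suc:
  assumes "envy_graph n u h {1..k} p src" "envier u h {1..n} (Suc k) (p' (Suc k))" "k < n"
    and "\<And>i. i \<noteq> Suc k \<Longrightarrow> p' i = p i"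
  shows "envy_graph n u h {1..Suc k} p' (if p' (Suc k) = 0 then Suc k else src)"
proof (cases "p' (Suc k) = 0")
  case True
  then show ?thesis using assms(2,3) by (simp add: envy_graph_def envier_def)
next
  case False
  have "{1..Suc k} = insert (Suc k) {1..k}" by auto
  then show ?thesis using assms False by (cases "src = 0") (simp_all add: envy_graph_def envier_def)
qed

lemma run_find_enviers:
  assumes n: "fst s (''n'', 0, 0) = n" "n \<le> K" and src: "fst s (''src'', 0, 0) = 0"
    and u: "\<And>i b. snd s (''val'', i, b) = u i b" and h: "\<And>i. fst s (''h'', i, 0) = h i"
  shows "run K (For ''y'' ''n'' find_envier) s
    (\<lambda>r. envy_graph n u h {1..n} (\<lambda>i. fst r (''p'', i, 0)) (fst r (''src'', 0, 0)))"
proof (rule run_For[where N = n and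
      I = "\<lambda>k r. envy_graph n u h {1..k} (\<lambda>i. fst r (''p'', i, 0)) (fst r (''src'', 0, 0))"])
  fix k r
  assume k: "k < n" and y: "fst r (''y'', 0, 0) = Suc k"
    and I: "envy_graph n u h {1..k} (\<lambda>i. fst r (''p'', i, 0)) (fst r (''src'', 0, 0))"
    and un: "unchanged (insert ''y'' (writes find_envier)) s r"
  have r: "fst r (''n'', 0, 0) = n" "\<And>i b. snd r (''val'', i, b) = u i b"
      "\<And>i. fst r (''h'', i, 0) = h i"
    using un n u h by (simp_all add: unchangedD)
  show "run K find_envier r
    (\<lambda>r. envy_graph n u h {1..Suc k} (\<lambda>i. fst r (''p'', i, 0)) (fst r (''src'', 0, 0)))"
  proof (rule run_conseq[OF run_find_envier[OF r(1) n(2) y r(2,3)]], elim conjE)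
    fix q :: state
    assume "envier u h {1..n} (Suc k) (fst q (''p'', Suc k, 0))"
      and "\<forall>i. i \<noteq> Suc k \<longrightarrow> fst q (''p'', i, 0) = fst r (''p'', i, 0)"
      and src: "fst q (''src'', 0, 0) = (if fst q (''p'', Suc k, 0) = 0 then Suc k else fst r (''src'', 0, 0))"
    then show "envy_graph n u h {1..Suc k} (\<lambda>i. fst q (''p'', i, 0)) (fst q (''src'', 0, 0))"
      unfolding src by (intro envy_graph_Suc[OF I _ k]) blast+
  qed
next
  show "envy_graph n u h {1..0} (\<lambda>i. fst s (''p'', i, 0)) (fst s (''src'', 0, 0))"
    using src by (simp add: envy_graph_def)
qed (use n in simp_all)

lemma run_walk:
  assumes n: "fst s (''n'', 0, 0) = n" "n \<le> K" and p: "\<And>i. fst s (''p'', i, 0) = p i"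
  shows "run K walk s (\<lambda>r. fst r (''x'', 0, 0) = (p ^^ n) 1)"
  unfolding walk_def
proof (rule run_Seq', rule run_NAssign, rule run_For[where I = "\<lambda>k r. fst r (''x'', 0, 0) = (p ^^ k) 1" and N = n])
  fix k r
  assume x: "fst r (''x'', 0, 0) = (p ^^ k) 1"
    and un: "unchanged (insert ''k'' (writes (set_var ''x'' (arr ''p'' (var ''x'')))))
      ((fst s)((''x'', nval (NConst 0) s, nval (NConst 0) s) := nval (NConst 1) s), snd s) r"
  have "\<And>i. fst r (''p'', i, 0) = p i" using un p by (simp add: unchangedD)
  then show "run K (set_var ''x'' (arr ''p'' (var ''x''))) r (\<lambda>r. fst r (''x'', 0, 0) = (p ^^ Suc k) 1)"
    using x by (intro run_NAssign) simp
qed (use n in simp_all)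

lemma run_swap_holders:
  assumes "fst s (''x'', 0, 0) = x" "fst s (''y'', 0, 0) = y" "x \<noteq> y"
    and h: "\<And>i. fst s (''h'', i, 0) = h i" and p: "\<And>i. fst s (''p'', i, 0) = p i"
  shows "run K swap_holders s (\<lambda>r. fst r (''y'', 0, 0) = p y \<and>
    (\<lambda>i. fst r (''h'', i, 0)) = h(x := h y, y := h x))"
  unfolding swap_holders_def
  by (intro run_If run_Skip run_Seq' run_NAssign) (use assms in \<open>simp_all add: fun_eq_iff\<close>)

lemma run_rotate_cycle:
  fixes u :: "nat \<Rightarrow> nat \<Rightarrow> real"
  assumes n: "fst s (''n'', 0, 0) = n" "n \<le> K"
    and h: "h = (\<lambda>i. fst s (''h'', i, 0))" "inj_on h {1..n}" "h ` {1..n} \<subseteq> {1..n}"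
    and p: "p = (\<lambda>i. fst s (''p'', i, 0))" "p ` {1..n} \<subseteq> {1..n}"
      "\<And>y. y \<in> {1..n} \<Longrightarrow> u (p y) (h (p y)) < u (p y) (h y)"
    and x: "fst s (''x'', 0, 0) = x" "x \<in> {1..n}"
    and cycle: "0 < k0" "k0 \<le> n" "(p ^^ k0) x = x"
    and Q: "\<And>r h'. h' = (\<lambda>i. fst r (''h'', i, 0)) \<Longrightarrow> inj_on h' {1..n} \<Longrightarrow> h' ` {1..n} \<subseteq> {1..n} \<Longrightarrow>
      u x (h x) < u x (h' x) \<Longrightarrow> (\<And>i. i \<in> {1..n} \<Longrightarrow> u i (h i) \<le> u i (h' i)) \<Longrightarrow>
      unchanged (writes rotate_cycle) s r \<Longrightarrow> Q r"
  shows "run K rotate_cycle s Q"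
proof -
  \<comment> \<open>\<open>rotation_Suc\<close> wants a cycle without repetitions, hence the least
    return time; \<open>k0\<close> shows that one exists and is at most \<open>n\<close>.\<close>
  define k where "k = (LEAST k. 0 < k \<and> (p ^^ k) x = x)"
  have k: "0 < k" "(p ^^ k) x = x"
    using LeastI[of "\<lambda>k. 0 < k \<and> (p ^^ k) x = x" k0] cycle unfolding k_def by auto
  have "k \<le> k0" unfolding k_def using cycle by (intro Least_le) simp
  then have kn: "k \<le> n" using cycle(2) by simp
  have least: "(p ^^ j) x \<noteq> x" if "0 < j" "j < k" for j
    using not_less_Least[of j "\<lambda>k. 0 < k \<and> (p ^^ k) x = x"] that unfolding k_def by simp
  \<comment> \<open>The number of swaps saturates at \<open>k - 1\<close>; from then on
    \<open>y\<close> is \<open>(p ^^ k) x = x\<close> and the body idles.\<close>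
  define I where "I c r \<longleftrightarrow> fst r (''y'', 0, 0) = (p ^^ Suc (min c (k - 1))) x \<and>
    rotation n u h p x k (min c (k - 1)) (\<lambda>i. fst r (''h'', i, 0))" for c and r :: state
  let ?s = "((fst s)((''y'', nval (NConst 0) s, nval (NConst 0) s) := nval (arr ''p'' (var ''x'')) s), snd s)"
  have loop: "run K (For ''k'' ''n'' swap_holders) ?s (I n)"
  proof (rule run_For[where I = I and N = n])
    fix c r
    assume I: "I c r" and un: "unchanged (insert ''k'' (writes swap_holders)) ?s r"
    have r: "fst r (''x'', 0, 0) = x" "\<And>i. fst r (''p'', i, 0) = p i"
      using un x p(1) by (simp_all add: unchangedD)
    have y: "fst r (''y'', 0, 0) = (p ^^ Suc (min c (k - 1))) x"
      and rot: "rotation n u h p x k (min c (k - 1)) (\<lambda>i. fst r (''h'', i, 0))"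
      using I by (simp_all only: I_def)
    show "run K swap_holders r (I (Suc c))"
    proof (cases "Suc c < k")
      case True
      then have c: "min c (k - 1) = c" "min (Suc c) (k - 1) = Suc c" by auto
      define y where "y = (p ^^ Suc c) x"
      have ry: "fst r (''y'', 0, 0) = y" using y by (simp only: c y_def)
      have "y \<noteq> x" using least[of "Suc c"] True by (simp add: y_def)
      define h' where "h' = (\<lambda>i. fst r (''h'', i, 0))"
      have "rotation n u h p x k (Suc c) (h'(x := h' y, y := h' x))"
        by (rule rotation_Suc[where u = u and h = h and h' = h', OF _ True p(2,3) x(2) k(2) least y_def])
            (use rot c h'_def in auto)
      moreover have "(p ^^ Suc (Suc c)) x = p y" by (simp add: y_def)
      moreover have "x \<noteq> y" using \<open>y \<noteq> x\<close> by simp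
      ultimately show ?thesis
        by (intro run_conseq[OF run_swap_holders[OF r(1) ry _ _ r(2), of h']])
          (simp_all only: I_def c h'_def simp_thms)
    next
      case False
      then have c: "min c (k - 1) = k - 1" "min (Suc c) (k - 1) = k - 1" by auto
      have "Suc (k - 1) = k" using k(1) by simp
      then have "fst r (''y'', 0, 0) = x" using y k(2) by (simp only: c)
      moreover have "I (Suc c) r" using I by (simp only: I_def c)
      ultimately show ?thesis
        unfolding swap_holders_def by (intro run_If run_Skip) (simp_all add: r)
    qed
  next
    show "I 0 ?s" using h p(1) x(1) by (simp add: I_def rotation_0)
  qed (use n in \<open>simp_all add: I_def\<close>)
  show ?thesis
  proof (rule run_conseq[of K _ s "I n"])
    show "run K rotate_cycle s (I n)"
      unfolding rotate_cycle_def using loop by (intro run_Seq' run_NAssign)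
  next
    fix r assume "I n r" and un: "unchanged (writes rotate_cycle) s r"
    moreover have "min n (k - 1) = k - 1" using kn by simp
    ultimately have rot: "rotation n u h p x k (k - 1) (\<lambda>i. fst r (''h'', i, 0))" by (simp add: I_def)
    show "Q r"
    proof (rule Q[OF refl _ _ _ _ un])
      show "inj_on (\<lambda>i. fst r (''h'', i, 0)) {1..n}" "(\<lambda>i. fst r (''h'', i, 0)) ` {1..n} \<subseteq> {1..n}"
        using rot unfolding rotation_def by blast+
    qed (use rotation_end[OF rot k(1) p(2) x(2) p(3) k(2)] in blast)+
  qed
qed

text \<open>While no source has been found, each improvement decreases the envy; hence one is found within
  \<open>n * n\<close> rounds.\<close>

definition source_search ::
  "nat \<Rightarrow> (nat \<Rightarrow> nat \<Rightarrow> real) \<Rightarrow> (nat \<Rightarrow> nat) \<Rightarrow> nat \<Rightarrow> (nat \<Rightarrow> nat) \<Rightarrow> nat \<Rightarrow> bool" where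
  "source_search n u h e h' src \<longleftrightarrow>
     inj_on h' {1..n} \<and> h' ` {1..n} \<subseteq> {1..n} \<and> (\<forall>i\<in>{1..n}. u i (h i) \<le> u i (h' i)) \<and>
     (if src = 0 then envy n u h' + e < n * n
      else src \<in> {1..n} \<and> (\<forall>z\<in>{1..n}. u z (h' src) \<le> u z (h' z)))"

text \<open>The drop in envy pays for the increment of \<open>e\<close>, which keeps their sum below
  \<open>n * n\<close>.\<close>

lemma source_search_improve:
  assumes s: "source_search n u h e h' 0"
    and h'': "inj_on h'' {1..n}" "h'' ` {1..n} \<subseteq> {1..n}"
    and le: "\<And>i. i \<in> {1..n} \<Longrightarrow> u i (h' i) \<le> u i (h'' i)"
    and x: "x \<in> {1..n}" "u x (h' x) < u x (h'' x)"
  shows "source_search n u h (Suc e) h'' 0"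
proof -
  have "h'' x \<in> {1..n}" using h''(2) x(1) by blast
  then have "envy n u h'' < envy n u h'" by (intro envy_decreases[where u = u, OF le x]) simp_all
  moreover have "envy n u h' + e < n * n" using s by (simp add: source_search_def)
  ultimately have "envy n u h'' + Suc e < n * n" by simp
  moreover have "u i (h i) \<le> u i (h'' i)" if "i \<in> {1..n}" for i
  proof -
    have "u i (h i) \<le> u i (h' i)" using s that unfolding source_search_def by blast
    then show ?thesis using le[OF that] by simp
  qed
  ultimately show ?thesis using h'' by (simp add: source_search_def)
qed

text \<open>With a nonzero source the round counter no longer constrains anything, hence the
  arbitrary \<open>e'\<close>.\<close>

lemma source_search_found:
  assumes "source_search n u h e h' src'" "src \<noteq> 0" "envy_graph n u h' Y p src"
  shows "source_search n u h e' h' src"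
  using assms by (simp add: source_search_def envy_graph_def)

lemma run_improve:
  fixes u :: "nat \<Rightarrow> nat \<Rightarrow> real"
  assumes n: "fst s (''n'', 0, 0) = n" "1 \<le> n" "n \<le> K"
    and u: "\<And>i b. snd s (''val'', i, b) = u i b"
    and search: "source_search n u h e (\<lambda>i. fst s (''h'', i, 0)) (fst s (''src'', 0, 0))"
  shows "run K improve s
    (\<lambda>r. source_search n u h (Suc e) (\<lambda>i. fst r (''h'', i, 0)) (fst r (''src'', 0, 0)))"
proof -
  define h' where "h' = (\<lambda>i. fst s (''h'', i, 0))"
  let ?Q = "\<lambda>r. source_search n u h (Suc e) (\<lambda>i. fst r (''h'', i, 0)) (fst r (''src'', 0, 0))"
  show ?thesis
    unfolding improve_def
  proof (rule run_If)
    assume "\<not> bval (NEq (var ''src'') (NConst 0)) s"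
    then have "fst s (''src'', 0, 0) \<noteq> 0" by simp
    then have "?Q s" using search by (simp add: source_search_def)
    then show "run K Skip s ?Q" by (rule run_Skip)
  next
    assume "bval (NEq (var ''src'') (NConst 0)) s"
    then have src: "fst s (''src'', 0, 0) = 0" by simp
    show "run K (Seq (For ''y'' ''n'' find_envier)
       (If (NEq (var ''src'') (NConst 0)) (Seq walk rotate_cycle) Skip)) s ?Q"
    proof (rule run_Seq[OF run_find_enviers[OF n(1,3) src u, of h']])
      show "fst s (''h'', i, 0) = h' i" for i by (simp add: h'_def)
      fix q :: state
      define p where "p = (\<lambda>i. fst q (''p'', i, 0))"
      assume "envy_graph n u h' {1..n} (\<lambda>i. fst q (''p'', i, 0)) (fst q (''src'', 0, 0))"
        and un: "unchanged (writes (For ''y'' ''n'' find_envier)) s q"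
      then have graph: "envy_graph n u h' {1..n} p (fst q (''src'', 0, 0))" by (simp add: p_def)
      have q: "fst q (''n'', 0, 0) = n" "(\<lambda>i. fst q (''h'', i, 0)) = h'"
        using un n by (simp_all add: unchangedD h'_def)
      show "run K (If (NEq (var ''src'') (NConst 0)) (Seq walk rotate_cycle) Skip) q ?Q"
      proof (rule run_If)
        assume "\<not> bval (NEq (var ''src'') (NConst 0)) q"
        then have "?Q q"
          using source_search_found[OF search[folded h'_def] _ graph] by (simp add: q)
        then show "run K Skip q ?Q" by (rule run_Skip)
      next
        assume "bval (NEq (var ''src'') (NConst 0)) q"
        then have src_q: "fst q (''src'', 0, 0) = 0" by simp
        \<comment> \<open>Without a source every agent has an envier, so \<open>p\<close> is a
          self-map of the agents and can be followed indefinitely.\<close>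
        have p: "p ` {1..n} \<subseteq> {1..n}"
            "\<And>y. y \<in> {1..n} \<Longrightarrow> u (p y) (h' (p y)) < u (p y) (h' y)"
          using graph unfolding src_q envy_graph_def by auto
        define x where "x = (p ^^ n) 1"
        have one: "1 \<in> {1..n}" using n by simp
        have x: "x \<in> {1..n}" unfolding x_def by (rule funpow_in[OF p(1) one])
        obtain k where k: "0 < k" "k \<le> n" "(p ^^ k) x = x"
          using funpow_reaches_cycle[OF p(1) one] unfolding x_def by blast
        have h': "inj_on h' {1..n}" "h' ` {1..n} \<subseteq> {1..n}"
          using search unfolding source_search_def h'_def by blast+
        show "run K (Seq walk rotate_cycle) q ?Q"
        proof (rule run_Seq[OF run_walk[OF q(1) n(3), of p]])
          show "fst q (''p'', i, 0) = p i" for i by (simp add: p_def)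
          fix r :: state
          assume "fst r (''x'', 0, 0) = (p ^^ n) 1" and un: "unchanged (writes walk) q r"
          then have rx: "fst r (''x'', 0, 0) = x" by (simp add: x_def)
          have rn: "fst r (''n'', 0, 0) = n" using un q(1) by (simp add: unchangedD)
          have rh: "h' = (\<lambda>i. fst r (''h'', i, 0))" using un q(2) by (simp add: unchangedD)
          have rp: "p = (\<lambda>i. fst r (''p'', i, 0))" using un by (simp add: unchangedD p_def)
          have rsrc: "fst r (''src'', 0, 0) = 0" using un src_q by (simp add: unchangedD)
          show "run K rotate_cycle r ?Q"
          proof (rule run_rotate_cycle[OF rn n(3) rh h' rp p rx x k])
            fix r' :: state and h''
            assume h'': "h'' = (\<lambda>i. fst r' (''h'', i, 0))" "inj_on h'' {1..n}" "h'' ` {1..n} \<subseteq> {1..n}"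
              and less: "u x (h' x) < u x (h'' x)"
              and le: "\<And>i. i \<in> {1..n} \<Longrightarrow> u i (h' i) \<le> u i (h'' i)"
              and un': "unchanged (writes rotate_cycle) r r'"
            have "fst r' (''src'', 0, 0) = 0" using un' rsrc by (simp add: unchangedD)
            moreover have "source_search n u h (Suc e) h'' 0"
              by (rule source_search_improve[OF search[unfolded src, folded h'_def] h''(2,3) le x less])
            ultimately show "?Q r'" by (simp add: h''(1))
          qed
        qed
      qed
    qed
  qed
qed

lemma run_find_source:
  fixes u :: "nat \<Rightarrow> nat \<Rightarrow> real"
  assumes n: "fst s (''n'', 0, 0) = n" "1 \<le> n" "n \<le> K"
    and u: "\<And>i b. snd s (''val'', i, b) = u i b"
    and h: "h = (\<lambda>i. fst s (''h'', i, 0))" "inj_on h {1..n}" "h ` {1..n} \<subseteq> {1..n}"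
  shows "run K find_source s
    (\<lambda>r. source_search n u h (n * n) (\<lambda>i. fst r (''h'', i, 0)) (fst r (''src'', 0, 0)))"
  unfolding find_source_def
proof (rule run_Seq', rule run_NAssign)
  let ?s = "((fst s)((''src'', nval (NConst 0) s, nval (NConst 0) s) := nval (NConst 0) s), snd s)"
  let ?I = "\<lambda>e r. source_search n u h e (\<lambda>i. fst r (''h'', i, 0)) (fst r (''src'', 0, 0))"
  show "run K (For ''a'' ''n'' (For ''e'' ''n'' improve)) ?s (?I (n * n))"
  proof (rule run_For[where N = n and I = "\<lambda>a. ?I (a * n)"])
    fix a r
    assume I: "?I (a * n) r" and un: "unchanged (insert ''a'' (writes (For ''e'' ''n'' improve))) ?s r"
    have r: "fst r (''n'', 0, 0) = n" "\<And>i b. snd r (''val'', i, b) = u i b"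
      using un n u by (simp_all add: unchangedD)
    show "run K (For ''e'' ''n'' improve) r (?I (Suc a * n))"
    proof (rule run_For[where N = n and I = "\<lambda>e. ?I (a * n + e)"])
      fix e q
      assume I: "?I (a * n + e) q" and un: "unchanged (insert ''e'' (writes improve)) r q"
      have q: "fst q (''n'', 0, 0) = n" "\<And>i b. snd q (''val'', i, b) = u i b"
        using un r by (simp_all add: unchangedD)
      show "run K improve q (?I (a * n + Suc e))"
        using run_improve[OF q(1) n(2,3) q(2) I] by simp
    qed (use r I n in \<open>simp_all add: add.commute\<close>)
  next
    show "?I (0 * n) ?s"
      using h envy_bound[OF n(2) h(3), of u] by (simp add: source_search_def)
  qed (use n in simp_all)
qed

section \<open>Correctness of one round and of the whole program\<close>

context bounded_instance
begin

lemma bounds: "n \<le> n + m" "m \<le> n + m"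
  by simp_all

definition input :: "state \<Rightarrow> bool" where
  "input s \<longleftrightarrow> fst s (''n'', 0, 0) = n \<and> fst s (''m'', 0, 0) = m \<and>
     (\<forall>i\<in>{1..n}. \<forall>g\<in>{1..m}. snd s (''v'', i, g) = v i {g})"

lemma
  assumes "input s"
  shows input_n: "fst s (''n'', 0, 0) = n"
    and input_m: "fst s (''m'', 0, 0) = m"
    and input_v: "i \<in> {1..n} \<Longrightarrow> g \<in> {1..m} \<Longrightarrow> snd s (''v'', i, g) = v i {g}"
  using assms unfolding input_def by blast+

lemma input_unchanged:
  "input s \<Longrightarrow> unchanged W s r \<Longrightarrow> ''n'' \<notin> W \<Longrightarrow> ''m'' \<notin> W \<Longrightarrow> ''v'' \<notin> W \<Longrightarrow> input r"
  by (simp add: input_def unchangedD)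

text \<open>\<open>S\<close> holds the pairs examined so far. While \<open>best\<close> is
  \<open>0\<close>, the candidate \<open>c\<close> may be left over from an earlier round, so it is
  constrained only once \<open>best\<close> is positive.\<close>

definition scan :: "(nat \<Rightarrow> nat) \<Rightarrow> (nat \<times> nat) set \<Rightarrow> real \<Rightarrow> nat \<Rightarrow> bool" where
  "scan B S best c \<longleftrightarrow> 0 \<le> best \<and> (\<forall>i g. (i, g) \<in> S \<longrightarrow> B g = 0 \<longrightarrow> v i {g} \<le> best) \<and>
     (0 < best \<longrightarrow> c \<in> {1..m} \<and> B c = 0 \<and> (\<exists>i\<in>{1..n}. v i {c} = best))"

lemma scan_better:
  assumes "scan B S best c" "i \<in> {1..n}" "g \<in> {1..m}" "B g = 0" "best < v i {g}"
  shows "scan B (insert (i, g) S) (v i {g}) g"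
  unfolding scan_def
proof (intro conjI impI allI)
  show "0 \<le> v i {g}" using assms by (simp add: scan_def)
  fix i' g' assume x: "(i', g') \<in> insert (i, g) S" "B g' = 0"
  show "v i' {g'} \<le> v i {g}"
  proof (cases "(i', g') \<in> S")
    case True
    then have "v i' {g'} \<le> best" using assms(1) x(2) unfolding scan_def by blast
    then show ?thesis using assms(5) by simp
  qed (use x(1) in simp)
qed (use assms in blast)+

lemma scan_not_better:
  assumes "scan B S best c" "\<not> (B g = 0 \<and> best < v i {g})"
  shows "scan B (insert (i, g) S) best c"
  using assms by (auto simp: scan_def not_less simp del: atLeastAtMost_iff)

definition selected :: "(nat \<Rightarrow> nat) \<Rightarrow> nat \<Rightarrow> bool" where
  "selected B c \<longleftrightarrow> c \<in> {1..m} \<and> B c = 0 \<and> (\<forall>g\<in>{1..m}. B g = 0 \<longrightarrow> peak g \<le> peak c)"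

text \<open>Some agent values the free good \<open>g\<close>, so the maximum is positive and the
  candidate genuine. That maximum bounds the peak of every free good and is itself at most the peak
  of \<open>c\<close>.\<close>

lemma scan_selected:
  assumes scan: "scan B ({1..n} \<times> {1..m}) best c" and g: "g \<in> {1..m}" "B g = 0"
  shows "selected B c"
proof -
  have le: "v i {g} \<le> best" if "i \<in> {1..n}" "g \<in> {1..m}" "B g = 0" for i g
    using scan that unfolding scan_def by blast
  obtain i where "i \<in> {1..n}" "v i {g} > 0" using valued[OF g(1)] by blast
  then have "0 < best" using le[of i g] g by linarith
  then have c: "c \<in> {1..m}" "B c = 0" "\<exists>i\<in>{1..n}. v i {c} = best"
    using scan unfolding scan_def by blast+
  then have "best \<le> peak c" using le_peak by blast
  then have "peak g' \<le> peak c" if "g' \<in> {1..m}" "B g' = 0" for g'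
    using peak_le[of g' best] le that by fastforce
  then show ?thesis using c unfolding selected_def by blast
qed

lemma run_test_good:
  assumes s: "input s" "fst s (''i'', 0, 0) = i" "fst s (''g'', 0, 0) = g" "i \<in> {1..n}" "g \<in> {1..m}"
    and B: "\<And>g. fst s (''bun'', g, 0) = B g"
    and scan: "scan B S (snd s (''best'', 0, 0)) (fst s (''cur'', 0, 0))"
  shows "run K test_good s (\<lambda>r. scan B (insert (i, g) S) (snd r (''best'', 0, 0)) (fst r (''cur'', 0, 0)))"
proof -
  have v: "snd s (''v'', i, g) = v i {g}" by (rule input_v[OF s(1,4,5)])
  show ?thesis
    unfolding test_good_def
    by (intro run_If run_Seq' run_RAssign run_NAssign run_Skip)
      (simp_all add: s B v scan_better[OF scan s(4,5)] scan_not_better[OF scan])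
qed

lemma run_select_good:
  assumes s: "input s" and B: "B = (\<lambda>g. fst s (''bun'', g, 0))" and g: "g \<in> {1..m}" "B g = 0"
  shows "run (n + m) select_good s (\<lambda>r. selected B (fst r (''cur'', 0, 0)))"
  unfolding select_good_def
proof (rule run_Seq', rule run_RAssign)
  let ?s = "(fst s, (snd s)((''best'', nval (NConst 0) s, nval (NConst 0) s) := rval (RConst 0) s))"
  let ?I = "\<lambda>S r. scan B S (snd r (''best'', 0, 0)) (fst r (''cur'', 0, 0))"
  have s': "input ?s" using s by (simp add: input_def)
  show "run (n + m) (For ''i'' ''n'' (For ''g'' ''m'' test_good)) ?s
    (\<lambda>r. selected B (fst r (''cur'', 0, 0)))"
  proof (rule run_For[where N = n and I = "\<lambda>k. ?I ({1..k} \<times> {1..m})"])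
    fix k r
    assume k: "k < n" and I: "?I ({1..k} \<times> {1..m}) r" and i: "fst r (''i'', 0, 0) = Suc k"
      and un: "unchanged (insert ''i'' (writes (For ''g'' ''m'' test_good))) ?s r"
    have r: "input r" by (rule input_unchanged[OF s' un]) simp_all
    have rB: "fst r (''bun'', g, 0) = B g" for g using un B by (simp add: unchangedD)
    show "run (n + m) (For ''g'' ''m'' test_good) r (?I ({1..Suc k} \<times> {1..m}))"
    proof (rule run_For[where N = m and I = "\<lambda>l. ?I ({1..k} \<times> {1..m} \<union> {Suc k} \<times> {1..l})"])
      fix l q
      assume l: "l < m" and I: "?I ({1..k} \<times> {1..m} \<union> {Suc k} \<times> {1..l}) q"
        and g: "fst q (''g'', 0, 0) = Suc l" and un: "unchanged (insert ''g'' (writes test_good)) r q"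
      have q: "input q" by (rule input_unchanged[OF r un]) simp_all
      have qi: "fst q (''i'', 0, 0) = Suc k" using un i by (simp add: unchangedD)
      have qB: "fst q (''bun'', g, 0) = B g" for g using un rB by (simp add: unchangedD)
      have "insert (Suc k, Suc l) ({1..k} \<times> {1..m} \<union> {Suc k} \<times> {1..l}) =
          {1..k} \<times> {1..m} \<union> {Suc k} \<times> {1..Suc l}"
        by (auto simp: le_Suc_eq)
      then show "run (n + m) test_good q (?I ({1..k} \<times> {1..m} \<union> {Suc k} \<times> {1..Suc l}))"
        using run_test_good[OF q qi g _ _ qB I] k l by simp
    next
      fix q
      have "{1..k} \<times> {1..m} \<union> {Suc k} \<times> {1..m} = {1..Suc k} \<times> {1..m}" by (auto simp: le_Suc_eq)
      then show "?I ({1..k} \<times> {1..m} \<union> {Suc k} \<times> {1..m}) q \<Longrightarrow> ?I ({1..Suc k} \<times> {1..m}) q"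
        by simp
    qed (use I input_m[OF r] in simp_all)
  next
    show "?I ({1..0} \<times> {1..m}) ?s" by (simp add: scan_def)
  qed (use input_n[OF s'] scan_selected[where g = g] g in simp_all)
qed

lemma run_give_good:
  assumes s: "input s" and c: "fst s (''cur'', 0, 0) = c" "c \<in> {1..m}"
    and b: "fst s (''h'', fst s (''src'', 0, 0), 0) = b"
  shows "run (n + m) give_good s (\<lambda>r.
    (\<lambda>g. fst r (''bun'', g, 0)) = (\<lambda>g. fst s (''bun'', g, 0))(c := b) \<and>
    (\<forall>i\<in>{1..n}. \<forall>j. snd r (''val'', i, j) = snd s (''val'', i, j) + (if j = b then v i {c} else 0)))"
  unfolding give_good_def
proof (rule run_Seq', rule run_NAssign, rule run_Seq', rule run_NAssign)
  let ?B = "(\<lambda>g. fst s (''bun'', g, 0))(c := b)"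
  let ?s1 = "((fst s)((''t'', nval (NConst 0) s, nval (NConst 0) s) := nval (arr ''h'' (var ''src'')) s), snd s)"
  let ?s = "((fst ?s1)((''bun'', nval (var ''cur'') ?s1, nval (NConst 0) ?s1) := nval (var ''t'') ?s1), snd ?s1)"
  have s': "input ?s" using s by (simp add: input_def)
  let ?I = "\<lambda>k r. \<forall>i j. snd r (''val'', i, j) =
    snd s (''val'', i, j) + (if j = b \<and> i \<in> {1..k} then v i {c} else 0)"
  show "run (n + m) (For ''i'' ''n'' add_value) ?s (\<lambda>r.
    (\<lambda>g. fst r (''bun'', g, 0)) = ?B \<and>
    (\<forall>i\<in>{1..n}. \<forall>j. snd r (''val'', i, j) = snd s (''val'', i, j) + (if j = b then v i {c} else 0)))"
  proof (rule run_For[where N = n and I = ?I])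
    fix k r
    assume k: "k < n" and I: "?I k r" and i: "fst r (''i'', 0, 0) = Suc k"
      and un: "unchanged (insert ''i'' (writes add_value)) ?s r"
    have r: "input r" by (rule input_unchanged[OF s' un]) simp_all
    have rc: "fst r (''cur'', 0, 0) = c" "fst r (''t'', 0, 0) = b"
      using un c b by (simp_all add: unchangedD)
    have "snd r (''v'', Suc k, c) = v (Suc k) {c}" using input_v[OF r _ c(2)] k by simp
    then show "run (n + m) add_value r (?I (Suc k))"
      unfolding add_value_def
      by (intro run_RAssign) (use I i rc in \<open>auto simp: le_Suc_eq\<close>)
  next
    fix r assume "?I n r" and "unchanged (insert ''i'' (writes add_value)) ?s r"
    then show "(\<lambda>g. fst r (''bun'', g, 0)) = ?B \<and>
      (\<forall>i\<in>{1..n}. \<forall>j. snd r (''val'', i, j) = snd s (''val'', i, j) + (if j = b then v i {c} else 0))"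
      using c b by (auto simp: unchangedD fun_eq_iff)
  qed (use input_n[OF s'] in simp_all)
qed

definition consistent :: "state \<Rightarrow> bool" where
  "consistent s \<longleftrightarrow> input s \<and> valid (\<lambda>g. fst s (''bun'', g, 0)) (\<lambda>i. fst s (''h'', i, 0)) \<and>
     (\<forall>i\<in>{1..n}. \<forall>b\<in>{1..n}. snd s (''val'', i, b) = v i (contents (\<lambda>g. fst s (''bun'', g, 0)) b))"

text \<open>Its cardinality counts the rounds: each adds one good, so after \<open>m\<close> rounds
  it is everything.\<close>

definition assigned :: "(nat \<Rightarrow> nat) \<Rightarrow> nat set" where
  "assigned B = {g \<in> {1..m}. B g \<noteq> 0}"

lemma run_allocate_good:
  assumes s: "consistent s" and B: "B = (\<lambda>g. fst s (''bun'', g, 0))"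
    and card: "card (assigned B) = k" "k < m"
  shows "run (n + m) allocate_good s
    (\<lambda>r. consistent r \<and> card (assigned (\<lambda>g. fst r (''bun'', g, 0))) = Suc k)"
proof -
  define h where "h = (\<lambda>i. fst s (''h'', i, 0))"
  \<comment> \<open>The search works with the raw table, which agrees with the bundle values only
    for agents and bundles in range; hence the range facts at each conversion below.\<close>
  define u where "u i b = snd s (''val'', i, b)" for i b
  have inp: "input s" and valid: "valid B h"
    and u: "\<And>i b. i \<in> {1..n} \<Longrightarrow> b \<in> {1..n} \<Longrightarrow> u i b = v i (contents B b)"
    using s unfolding consistent_def B h_def u_def by blast+
  have "assigned B \<noteq> {1..m}" using card by auto
  then obtain g where g: "g \<in> {1..m}" "B g = 0" unfolding assigned_def by blast
  show ?thesis
    unfolding allocate_good_def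
  proof (rule run_Seq[OF run_select_good[OF inp B g]])
    fix r :: state
    define c where "c = fst r (''cur'', 0, 0)"
    assume "selected B (fst r (''cur'', 0, 0))" and un: "unchanged (writes select_good) s r"
    then have c: "c \<in> {1..m}" "B c = 0" "\<And>g. g \<in> {1..m} \<Longrightarrow> B g = 0 \<Longrightarrow> peak g \<le> peak c"
      unfolding selected_def c_def by blast+
    have r: "input r" by (rule input_unchanged[OF inp un]) simp_all
    have ru: "\<And>i b. snd r (''val'', i, b) = u i b" using un by (simp add: unchangedD u_def)
    have rh: "h = (\<lambda>i. fst r (''h'', i, 0))" using un by (simp add: unchangedD h_def)
    have rB: "(\<lambda>g. fst r (''bun'', g, 0)) = B" using un B by (simp add: unchangedD)
    show "run (n + m) (Seq find_source give_good) r
      (\<lambda>r. consistent r \<and> card (assigned (\<lambda>g. fst r (''bun'', g, 0))) = Suc k)"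
    proof (rule run_Seq[OF run_find_source[OF input_n[OF r] n_pos bounds(1) ru rh
            valid_inj[OF valid] valid_image[OF valid]]])
      fix q :: state
      define h' where "h' = (\<lambda>i. fst q (''h'', i, 0))"
      define x where "x = fst q (''src'', 0, 0)"
      assume "source_search n u h (n * n) (\<lambda>i. fst q (''h'', i, 0)) (fst q (''src'', 0, 0))"
        and un: "unchanged (writes find_source) r q"
      then have search: "source_search n u h (n * n) h' x" by (simp only: h'_def x_def)
      have q: "input q" by (rule input_unchanged[OF r un]) simp_all
      have qc: "fst q (''cur'', 0, 0) = c" using un by (simp add: unchangedD c_def)
      have qu: "snd q (''val'', i, b) = u i b" for i b using un ru by (simp add: unchangedD)
      have qB: "(\<lambda>g. fst q (''bun'', g, 0)) = B" using un rB by (simp add: unchangedD)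
      have h': "inj_on h' {1..n}" "h' ` {1..n} \<subseteq> {1..n}"
        and better: "\<And>i. i \<in> {1..n} \<Longrightarrow> u i (h i) \<le> u i (h' i)"
        using search unfolding source_search_def by blast+
      \<comment> \<open>The search cannot run out of rounds: that would leave the envy plus
        \<open>n * n\<close> below \<open>n * n\<close>.\<close>
      have "x \<noteq> 0"
      proof
        assume "x = 0"
        then have "envy n u h' + n * n < n * n" using search unfolding source_search_def by presburger
        then show False by simp
      qed
      then have x: "x \<in> {1..n}" and source: "\<And>i. i \<in> {1..n} \<Longrightarrow> u i (h' x) \<le> u i (h' i)"
        using search unfolding source_search_def by auto
      have h'n: "\<And>i. i \<in> {1..n} \<Longrightarrow> h' i \<in> {1..n}" using h'(2) by blast
      have valid': "valid B h'"
        by (rule valid_improve[OF valid h']) (use better u valid_holds[OF valid] h'n in force)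
      have unenvied: "v i (contents B (h' x)) \<le> v i (contents B (h' i))" if "i \<in> {1..n}" for i
        using source[OF that] u[OF that h'n[OF that]] u[OF that h'n[OF x]] by simp
      note give = valid_give[OF valid' c x unenvied]
      have b: "fst q (''h'', fst q (''src'', 0, 0), 0) = h' x" by (simp add: h'_def x_def)
      show "run (n + m) give_good q
        (\<lambda>r. consistent r \<and> card (assigned (\<lambda>g. fst r (''bun'', g, 0))) = Suc k)"
      proof (rule run_conseq[OF run_give_good[OF q qc c(1) b]], elim conjE)
        fix w :: state
        assume "(\<lambda>g. fst w (''bun'', g, 0)) = (\<lambda>g. fst q (''bun'', g, 0))(c := h' x)"
          and val: "\<forall>i\<in>{1..n}. \<forall>j. snd w (''val'', i, j) =
            snd q (''val'', i, j) + (if j = h' x then v i {c} else 0)"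
          and un: "unchanged (writes give_good) q w"
        then have wB: "(\<lambda>g. fst w (''bun'', g, 0)) = B(c := h' x)" by (simp add: qB)
        have wh: "(\<lambda>i. fst w (''h'', i, 0)) = h'" using un by (simp add: unchangedD h'_def)
        have "input w" by (rule input_unchanged[OF q un]) simp_all
        moreover have "valid (B(c := h' x)) h'" by (rule give(1))
        moreover have "snd w (''val'', i, b) = v i (contents (B(c := h' x)) b)"
          if "i \<in> {1..n}" "b \<in> {1..n}" for i b
        proof -
          have "v i (contents (B(c := h' x)) b) = v i (contents B b) + (if b = h' x then v i {c} else 0)"
            using that by (intro give(2))
          then show ?thesis using val that by (simp add: qu u)
        qed
        ultimately have "consistent w" unfolding consistent_def wB wh by blast
        moreover have "assigned (B(c := h' x)) = insert c (assigned B)"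
          using c(1) h'n[OF x] by (auto simp: assigned_def)
        then have "card (assigned (B(c := h' x))) = Suc k"
          using c(2) card(1) by (simp add: assigned_def)
        ultimately show "consistent w \<and> card (assigned (\<lambda>g. fst w (''bun'', g, 0))) = Suc k"
          by (simp add: wB)
      qed
    qed
  qed
qed

lemma run_test_owner:
  assumes "fst s (''g'', 0, 0) = g" "fst s (''i'', 0, 0) = i"
    and "fst s (''h'', i, 0) = h i" "fst s (''bun'', g, 0) = B g"
  shows "run K test_owner s
    (\<lambda>r. (\<lambda>g. fst r (''owner'', g, 0)) =
      (\<lambda>g. fst s (''owner'', g, 0))(g := if h i = B g then i else fst s (''owner'', g, 0)))"
  unfolding test_owner_def
  by (intro run_If run_NAssign run_Skip) (use assms in \<open>simp_all add: fun_eq_iff\<close>)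

definition owner_ok :: "(nat \<Rightarrow> nat) \<Rightarrow> (nat \<Rightarrow> nat) \<Rightarrow> nat \<Rightarrow> nat \<Rightarrow> bool" where
  "owner_ok B h g i \<longleftrightarrow> i \<in> {1..n} \<and> h i = B g"

lemma run_test_owners:
  assumes s: "input s" and valid: "valid B h" and B: "\<And>g. g \<in> {1..m} \<Longrightarrow> B g \<noteq> 0"
    and sB: "\<And>g. fst s (''bun'', g, 0) = B g" and sh: "\<And>i. fst s (''h'', i, 0) = h i"
  shows "run (n + m) (For ''g'' ''m'' (For ''i'' ''n'' test_owner)) s
    (\<lambda>r. \<forall>g\<in>{1..m}. owner_ok B h g (fst r (''owner'', g, 0)))"
proof (rule run_For[where N = m and
      I = "\<lambda>k r. \<forall>g\<in>{1..k}. owner_ok B h g (fst r (''owner'', g, 0))"])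
  fix k r
  assume k: "k < m" and I: "\<forall>g\<in>{1..k}. owner_ok B h g (fst r (''owner'', g, 0))"
    and g: "fst r (''g'', 0, 0) = Suc k"
    and un: "unchanged (insert ''g'' (writes (For ''i'' ''n'' test_owner))) s r"
  have r: "input r" by (rule input_unchanged[OF s un]) simp_all
  have rB: "\<And>g. fst r (''bun'', g, 0) = B g" and rh: "\<And>i. fst r (''h'', i, 0) = h i"
    using un sB sh by (simp_all add: unchangedD)
  \<comment> \<open>Nothing is claimed about the cell until the holder has been met, hence the
    implication; after all \<open>n\<close> agents its premise holds because \<open>h\<close> is
    onto.\<close>
  let ?J = "\<lambda>l q. (\<forall>g\<in>{1..k}. owner_ok B h g (fst q (''owner'', g, 0))) \<and>
    ((\<exists>i\<in>{1..l}. h i = B (Suc k)) \<longrightarrow> owner_ok B h (Suc k) (fst q (''owner'', Suc k, 0)))"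
  show "run (n + m) (For ''i'' ''n'' test_owner) r
    (\<lambda>r. \<forall>g\<in>{1..Suc k}. owner_ok B h g (fst r (''owner'', g, 0)))"
  proof (rule run_For[where N = n and I = ?J])
    fix l q
    assume l: "l < n" and J: "?J l q" and i: "fst q (''i'', 0, 0) = Suc l"
      and un: "unchanged (insert ''i'' (writes test_owner)) r q"
    have q: "fst q (''g'', 0, 0) = Suc k" "fst q (''h'', Suc l, 0) = h (Suc l)"
        "fst q (''bun'', Suc k, 0) = B (Suc k)"
      using un rB rh g by (simp_all add: unchangedD)
    show "run (n + m) test_owner q (?J (Suc l))"
    proof (rule run_conseq[OF run_test_owner[where h = h and B = B, OF q(1) i q(2,3)]])
      fix w :: state
      assume w: "(\<lambda>g. fst w (''owner'', g, 0)) = (\<lambda>g. fst q (''owner'', g, 0))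
        (Suc k := if h (Suc l) = B (Suc k) then Suc l else fst q (''owner'', Suc k, 0))"
      have old: "owner_ok B h g (fst w (''owner'', g, 0))" if "g \<in> {1..k}" for g
      proof -
        have "fst w (''owner'', g, 0) = fst q (''owner'', g, 0)"
          using fun_cong[OF w, of g] that by simp
        then show ?thesis using J that by simp
      qed
      have "owner_ok B h (Suc k) (fst w (''owner'', Suc k, 0))" if "\<exists>i\<in>{1..Suc l}. h i = B (Suc k)"
      proof (cases "h (Suc l) = B (Suc k)")
        case True
        then show ?thesis using fun_cong[OF w, of "Suc k"] l by (simp add: owner_ok_def)
      next
        case False
        then have "\<exists>i\<in>{1..l}. h i = B (Suc k)" using that by (auto simp: le_Suc_eq)
        then show ?thesis using fun_cong[OF w, of "Suc k"] J False by simp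
      qed
      with old show "?J (Suc l) w" by blast
    qed
  next
    fix q assume J: "?J n q"
    have "B (Suc k) \<in> {1..n}" using B[of "Suc k"] valid_le[OF valid, of "Suc k"] k by simp
    then obtain i where "i \<in> {1..n}" "h i = B (Suc k)" by (rule valid_surj[OF valid])
    then show "\<forall>g\<in>{1..Suc k}. owner_ok B h g (fst q (''owner'', g, 0))"
      using J by (simp add: atLeastAtMostSuc_conv del: atLeastAtMost_iff) blast
  qed (use I input_n[OF r] in simp_all)
qed (use input_m[OF s] in simp_all)

text \<open>As long as no good is assigned, the order and the bound in \<open>valid\<close> hold
  vacuously and all bundle values are \<open>0\<close>, as is the fresh table.\<close>

lemma consistent_initial:
  assumes s: "input s" "\<And>i. i \<in> {1..n} \<Longrightarrow> fst s (''h'', i, 0) = i"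
    and zero: "\<And>g. fst s (''bun'', g, 0) = 0" "\<And>i b. snd s (''val'', i, b) = 0"
  shows "consistent s"
proof -
  have empty: "contents (\<lambda>g. 0) b = {}" if "b \<in> {1..n}" for b
    using that by (simp add: contents_def)
  have "v i {} = 0" if "i \<in> {1..n}" for i using additive[OF that, of "{}"] by simp
  moreover have "valid (\<lambda>g. 0) (\<lambda>i. fst s (''h'', i, 0))"
    unfolding valid_def using s(2) by (auto simp: empty inj_on_def)
  ultimately show ?thesis using s(1) by (simp add: consistent_def zero empty del: atLeastAtMost_iff)
qed

lemma run_tEFx_program:
  "run (n + m) tEFx_program (input_state n m v)
    (\<lambda>r. allocation n m (output_allocation m r) \<and> tEFx n m v (output_allocation m r))"
  unfolding tEFx_program_def
proof -
  let ?s = "input_state n m v"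
  let ?Q = "\<lambda>r. allocation n m (output_allocation m r) \<and> tEFx n m v (output_allocation m r)"
  let ?init = "For ''i'' ''n'' (set_arr ''h'' (var ''i'') (var ''i''))"
  let ?B = "\<lambda>r g. fst r (''bun'', g, 0)"
  have s: "input ?s" by (simp add: input_def input_state_def)
  have "run (n + m) ?init ?s (\<lambda>r. \<forall>i\<in>{1..n}. fst r (''h'', i, 0) = i)"
  proof (rule run_For[where N = n and I = "\<lambda>k r. \<forall>i\<in>{1..k}. fst r (''h'', i, 0) = i"])
    fix k and r :: state
    assume "\<forall>i\<in>{1..k}. fst r (''h'', i, 0) = i" "fst r (''i'', 0, 0) = Suc k"
    then show "run (n + m) (set_arr ''h'' (var ''i'') (var ''i'')) r
        (\<lambda>r. \<forall>i\<in>{1..Suc k}. fst r (''h'', i, 0) = i)"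
      by (intro run_NAssign) (auto simp: le_Suc_eq)
  qed (use input_n[OF s] in simp_all)
  then show "run (n + m) (Seq ?init
      (Seq (For ''r'' ''m'' allocate_good) (For ''g'' ''m'' (For ''i'' ''n'' test_owner)))) ?s ?Q"
  proof (rule run_Seq)
    fix r :: state
    assume h: "\<forall>i\<in>{1..n}. fst r (''h'', i, 0) = i" and un: "unchanged (writes ?init) ?s r"
    have r: "input r" by (rule input_unchanged[OF s un]) simp_all
    have zero: "\<And>g. ?B r g = 0" "\<And>i b. snd r (''val'', i, b) = 0"
      using un by (simp_all add: unchangedD input_state_def)
    have con: "consistent r" by (rule consistent_initial[OF r _ zero]) (use h in blast)
    have "run (n + m) (For ''r'' ''m'' allocate_good) r
      (\<lambda>q. consistent q \<and> card (assigned (?B q)) = m)"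
    proof (rule run_For[where N = m and I = "\<lambda>k q. consistent q \<and> card (assigned (?B q)) = k"])
      fix k q
      assume "k < m" "consistent q \<and> card (assigned (?B q)) = k"
      then show "run (n + m) allocate_good q (\<lambda>q. consistent q \<and> card (assigned (?B q)) = Suc k)"
        by (intro run_allocate_good[OF _ refl]) simp_all
    qed (use input_m[OF r] con zero in \<open>simp_all add: assigned_def consistent_def input_def\<close>)
    then show "run (n + m) (Seq (For ''r'' ''m'' allocate_good)
        (For ''g'' ''m'' (For ''i'' ''n'' test_owner))) r ?Q"
    proof (rule run_Seq, elim conjE)
      fix q :: state
      define B where "B = ?B q"
      define h where "h = (\<lambda>i. fst q (''h'', i, 0))"
      assume con: "consistent q" and card: "card (assigned (?B q)) = m"
      have q: "input q" and valid: "valid B h" using con unfolding consistent_def B_def h_def by blast+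
      have "assigned B \<subseteq> {1..m}" by (auto simp: assigned_def)
      then have "assigned B = {1..m}" using card by (intro card_subset_eq) (simp_all add: B_def)
      then have B: "\<And>g. g \<in> {1..m} \<Longrightarrow> B g \<noteq> 0" unfolding assigned_def by blast
      show "run (n + m) (For ''g'' ''m'' (For ''i'' ''n'' test_owner)) q ?Q"
      proof (rule run_conseq[OF run_test_owners[OF q valid B]])
        fix w :: state
        assume "\<forall>g\<in>{1..m}. owner_ok B h g (fst w (''owner'', g, 0))"
        then have w: "\<And>g. g \<in> {1..m} \<Longrightarrow>
            fst w (''owner'', g, 0) \<in> {1..n} \<and> h (fst w (''owner'', g, 0)) = B g"
          unfolding owner_ok_def by blast
        have "output_allocation m w = (\<lambda>i. {g \<in> {1..m}. fst w (''owner'', g, 0) = i})"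
          by (simp add: fun_eq_iff output_allocation_def)
        then show "?Q w" using valid_complete[OF valid B w] by simp
      qed (simp_all add: B_def h_def)
    qed
  qed
qed

end

theorem corollary7:
  "poly_time_computable
     (\<lambda>n m v. fair_division_instance n m v \<and> range_parameter n m v \<in> {1/2..1})
     (\<lambda>n m v A. allocation n m A \<and> tEFx n m v A)"
proof -
  \<comment> \<open>The polynomial depends on the program alone; it is evaluated at
    \<open>K = n + m\<close>, which dominates both loop limits.\<close>
  obtain p :: "nat poly" where p: "\<forall>K. cost K tEFx_program = poly p K"
    using cost_polynomial by blast
  have "\<exists>t s. exec tEFx_program (input_state n m v) t s \<and> t \<le> poly p (n + m) \<and>
      allocation n m (output_allocation m s) \<and> tEFx n m v (output_allocation m s)"
    if "fair_division_instance n m v \<and> range_parameter n m v \<in> {1/2..1}" for n m v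
  proof -
    interpret bounded_instance n m v using that by unfold_locales simp_all
    show ?thesis using run_tEFx_program p unfolding run_def by simp
  qed
  then show ?thesis unfolding poly_time_computable_def by blast
qed

end
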